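(* Let $A_m\in\mathbb{R}^{n\times n}$ be Hurwitz, $b\in\mathbb{R}^n$, and $\theta_b>0$. Then there exist $k>0$, $\tau_s>0$, $\underline{\delta}>0$ and $\bar\delta>0$ such that for all $\tau\in[0,\tau_s]$ and all $\hat\tau\ge 0$ with $\hat\tau\in[\tau-\underline\delta,\tau+\bar\delta]$, the transfer function $F(s;\tau,\hat\tau)$ is exponentially stable and $$f(\tau,\hat\tau)\,\theta_b<1 .$$
   Context: For a filter bandwidth $k>0$ and delays $\tau,\hat\tau\ge 0$ define the transfer functions $$F(s;\tau,\hat\tau):=-k\big(s+k e^{-\tau s}-k e^{-\hat\tau s}+k\big)^{-1},\qquad H(s):=(s\mathbb{I}-A_m)^{-1}b,$$ $$\Phi(s;\tau,\hat\tau):=H(s)\big(1+e^{-\tau s}F(s;\tau,\hat\tau)\big).$$ $F(s;\tau,\hat\tau)$ is called exponentially stable if there is $\alpha>0$ such that all roots $s\in\mathbb{C}$ of $s+k e^{-\tau s}-k e^{-\hat\tau s}+k=0$ satisfy $\operatorname{Re}s\le-\alpha$. When $F(s;\tau,\hat\tau)$ is exponentially stable, set $$f(\tau,\hat\tau):=\|\Phi(s;\tau,\hat\tau)\|_{\mathcal{L}_1},$$ where for a causal transfer function $G$ with vector-valued impulse response $g(t)$, $\|G\|_{\mathcal{L}_1}:=\int_0^\infty\|g(t)\|_2\,dt$. (All of $F,\Phi,f$ depend on $k$.) *)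

theory Defs
  imports "HOL-Analysis.Analysis"
begin

definition hurwitz :: "real^'n^'n \<Rightarrow> bool" where
  "hurwitz A \<longleftrightarrow>
     (\<forall>s v. v \<noteq> 0 \<and> map_matrix complex_of_real A *v v = s *s v \<longrightarrow> Re s < 0)"

definition F_denom :: "real \<Rightarrow> real \<Rightarrow> real \<Rightarrow> complex \<Rightarrow> complex" where
  "F_denom k \<tau> \<tau>' s =
     s + of_real k * exp (- of_real \<tau> * s) - of_real k * exp (- of_real \<tau>' * s) + of_real k"

definition F_tf :: "real \<Rightarrow> real \<Rightarrow> real \<Rightarrow> complex \<Rightarrow> complex" where
  "F_tf k \<tau> \<tau>' s = - of_real k * inverse (F_denom k \<tau> \<tau>' s)"

definition H_tf :: "real^'n^'n \<Rightarrow> real^'n \<Rightarrow> complex \<Rightarrow> complex^'n" where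
  "H_tf A b s = matrix_inv (mat s - map_matrix complex_of_real A) *v (\<chi> i. of_real (b $ i))"

definition Phi_tf ::
    "real \<Rightarrow> real^'n^'n \<Rightarrow> real^'n \<Rightarrow> real \<Rightarrow> real \<Rightarrow> complex \<Rightarrow> complex^'n" where
  "Phi_tf k A b \<tau> \<tau>' s = (1 + exp (- of_real \<tau> * s) * F_tf k \<tau> \<tau>' s) *s H_tf A b s"

definition F_exp_stable :: "real \<Rightarrow> real \<Rightarrow> real \<Rightarrow> bool" where
  "F_exp_stable k \<tau> \<tau>' \<longleftrightarrow> (\<exists>\<alpha>>0. \<forall>s. F_denom k \<tau> \<tau>' s = 0 \<longrightarrow> Re s \<le> - \<alpha>)"

text \<open>
  A causal impulse response of \<open>G\<close> is a function on the half-line whose Laplace transform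
  converges absolutely and equals \<open>G\<close> on some right half-plane. It is determined by \<open>G\<close> up to
  a null set; only its values at nonnegative times matter.
\<close>

definition impulse_response :: "(complex \<Rightarrow> complex^'n) \<Rightarrow> (real \<Rightarrow> real^'n) \<Rightarrow> bool" where
  "impulse_response G g \<longleftrightarrow>
     (\<exists>\<sigma>. \<forall>s i. Re s > \<sigma> \<longrightarrow>
        set_integrable lborel {0..} (\<lambda>t. exp (- of_real t * s) * of_real (g t $ i)) \<and>
        (LINT t:{0..}|lborel. exp (- of_real t * s) * of_real (g t $ i)) = G s $ i)"

text \<open>
  The \<open>\<L>\<^sub>1\<close> norm is extended-valued, so that it is infinite (rather than a default value)
  if the impulse response is not integrable. It is also set to infinity if no impulse response
  exists, so a finite bound on it asserts existence. The choice of the impulse response does not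
  matter by a.e. uniqueness; \<open>norm\<close> on \<open>real^'n\<close> is the Euclidean norm.
\<close>

definition L1_norm :: "(complex \<Rightarrow> complex^'n) \<Rightarrow> ennreal" where
  "L1_norm G =
     (if \<exists>g. impulse_response G g
      then \<integral>\<^sup>+t\<in>{0..}. ennreal (norm ((SOME g. impulse_response G g) t)) \<partial>lborel
      else \<infinity>)"

definition f_norm ::
    "real \<Rightarrow> real^'n^'n \<Rightarrow> real^'n \<Rightarrow> real \<Rightarrow> real \<Rightarrow> ennreal" where
  "f_norm k A b \<tau> \<tau>' = L1_norm (Phi_tf k A b \<tau> \<tau>')"

end

theory Submission
  imports Defs "HOL-Computational_Algebra.Fundamental_Theorem_Algebra"
begin

text \<open>
  Write \<open>K(s) = k / (s + k)\<close> and \<open>D(s) = K(s) (exp (- \<tau> s) - exp (- \<tau>' s))\<close>. Then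
  \<open>F = - K / (1 + D)\<close> and
  \<open>\<Phi> = (1 - K) H + K (1 - exp (- \<tau> s)) H + exp (- \<tau> s) K H D / (1 + D)\<close>.
  The first term equals \<open>(A H + b) / (s + k)\<close>, of \<open>\<L>\<^sub>1\<close> norm \<open>O(1 / k)\<close>. The factor
  \<open>K (1 - exp (- \<rho> s))\<close> has norm at most \<open>2 k \<rho>\<close>, being \<open>k s / (s + k)\<close> times the transform of the
  indicator of \<open>[0, \<rho>]\<close>; hence the second term is \<open>O(k \<tau>)\<close>, the norm of \<open>D\<close> is at most
  \<open>2 k \<bar>\<tau> - \<tau>'\<bar>\<close>, and a Neumann series for \<open>D / (1 + D)\<close> makes the third term \<open>O(k \<bar>\<tau> - \<tau>'\<bar>)\<close>.
  So one takes \<open>k\<close> large first and then the delay and the mismatch small compared with \<open>1 / k\<close>.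
\<close>

section \<open>Transfer functions with integrable impulse response\<close>

text \<open>Impulse responses are allowed to be complex, so that complex poles can be treated one at a
  time; \<open>c\<close> is only an upper bound for the norm, and nothing is said about \<open>G\<close> for \<open>Re s < 0\<close>.\<close>

definition L1_tf :: "(complex \<Rightarrow> complex) \<Rightarrow> real \<Rightarrow> bool" where
  "L1_tf G c \<longleftrightarrow> (\<exists>g. integrable lborel g \<and> (\<forall>t<0. g t = 0) \<and> (LINT t|lborel. norm (g t)) \<le> c \<and>
     (\<forall>s. Re s \<ge> 0 \<longrightarrow> (LINT t|lborel. exp (- of_real t * s) * g t) = G s))"

lemma laplace_kernel_measurable [measurable]:
  "(\<lambda>t. exp (- of_real t * s)) \<in> borel_measurable borel" for s :: complex
  by (intro borel_measurable_continuous_onI continuous_intros)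

lemma norm_laplace_kernel_le:
  fixes g :: "real \<Rightarrow> complex"
  assumes "\<forall>t<0. g t = 0" "Re s \<ge> 0"
  shows "norm (exp (- of_real t * s) * g t) \<le> norm (g t)"
proof (cases "t < 0")
  case False
  then have "norm (exp (- of_real t * s)) \<le> 1"
    using assms by simp
  then show ?thesis
    by (simp add: norm_mult mult_left_le_one_le)
qed (use assms in simp)

lemma laplace_integrable:
  fixes g :: "real \<Rightarrow> complex"
  assumes "integrable lborel g" "\<forall>t<0. g t = 0" "Re s \<ge> 0"
  shows "integrable lborel (\<lambda>t. exp (- of_real t * s) * g t)"
proof (rule Bochner_Integration.integrable_bound[OF assms(1)])
  have [measurable]: "g \<in> borel_measurable borel"
    using borel_measurable_integrable[OF assms(1)] by simp
  show "(\<lambda>t. exp (- of_real t * s) * g t) \<in> borel_measurable lborel"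
    by measurable
qed (use norm_laplace_kernel_le[OF assms(2,3)] in auto)

lemma L1_tfD:
  assumes "L1_tf G c"
  shows "\<exists>g. integrable lborel g \<and> (\<forall>t<0. g t = 0) \<and> (LINT t|lborel. norm (g t)) \<le> c \<and>
    (\<forall>s. Re s \<ge> 0 \<longrightarrow> (LINT t|lborel. exp (- of_real t * s) * g t) = G s) \<and>
    (\<forall>s. Re s \<ge> 0 \<longrightarrow> integrable lborel (\<lambda>t. exp (- of_real t * s) * g t))"
proof -
  obtain g where g: "integrable lborel g" "\<forall>t<0. g t = 0" "(LINT t|lborel. norm (g t)) \<le> c"
    "\<forall>s. Re s \<ge> 0 \<longrightarrow> (LINT t|lborel. exp (- of_real t * s) * g t) = G s"
    using assms unfolding L1_tf_def by blast
  then show ?thesis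
    using laplace_integrable[OF g(1,2)] by (intro exI[of _ g]) simp
qed

lemma L1_tfI:
  assumes "integrable lborel g" "\<And>t. t < 0 \<Longrightarrow> g t = 0" "(LINT t|lborel. norm (g t)) \<le> c"
    "\<And>s. Re s \<ge> 0 \<Longrightarrow> (LINT t|lborel. exp (- of_real t * s) * g t) = G s"
  shows "L1_tf G c"
  using assms unfolding L1_tf_def by blast

lemma L1_tf_weaken:
  assumes "L1_tf G c" "c \<le> c'" "\<And>s. Re s \<ge> 0 \<Longrightarrow> G s = G' s"
  shows "L1_tf G' c'"
proof -
  obtain g where "integrable lborel g" "\<forall>t<0. g t = 0" "(LINT t|lborel. norm (g t)) \<le> c"
    "\<And>s. Re s \<ge> 0 \<Longrightarrow> (LINT t|lborel. exp (- of_real t * s) * g t) = G s"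
    using L1_tfD[OF assms(1)] by blast
  then show ?thesis
    using assms(2,3) by (intro L1_tfI[of g]) auto
qed

text \<open>The Laplace kernel has modulus at most 1 where \<open>g\<close> lives. Through this
  bound a small \<open>c\<close> makes geometric series in \<open>G s\<close> converge and keeps
  \<open>1 + G s\<close> away from zero.\<close>

lemma L1_tf_norm_le:
  assumes "L1_tf G c" "Re s \<ge> 0"
  shows "norm (G s) \<le> c"
proof -
  obtain g where g: "integrable lborel g" "\<forall>t<0. g t = 0" "(LINT t|lborel. norm (g t)) \<le> c"
    "(LINT t|lborel. exp (- of_real t * s) * g t) = G s"
    using L1_tfD[OF assms(1)] assms(2) by blast
  have "norm (G s) \<le> (LINT t|lborel. norm (exp (- of_real t * s) * g t))"
    unfolding g(4)[symmetric] by (rule integral_norm_bound)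
  also have "\<dots> \<le> (LINT t|lborel. norm (g t))"
    using g(1,2) laplace_integrable[OF g(1,2) assms(2)] norm_laplace_kernel_le[OF g(2) assms(2)]
    by (intro integral_mono integrable_norm) auto
  finally show ?thesis using g(3) by linarith
qed

lemma L1_tf_nonneg: "L1_tf G c \<Longrightarrow> 0 \<le> c"
  by (rule order_trans[OF norm_ge_zero[of "G 0"]], rule L1_tf_norm_le) simp_all

lemma L1_tf_zero: "L1_tf (\<lambda>s. 0) 0"
  by (rule L1_tfI[of "\<lambda>t. 0"]) auto

section \<open>Closure under sums, delays, products and series\<close>

lemma L1_tf_add:
  assumes "L1_tf F c" "L1_tf G d"
  shows "L1_tf (\<lambda>s. F s + G s) (c + d)"
proof -
  obtain f where f: "integrable lborel f" "\<forall>t<0. f t = 0" "(LINT t|lborel. norm (f t)) \<le> c"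
    "\<And>s. Re s \<ge> 0 \<Longrightarrow> (LINT t|lborel. exp (- of_real t * s) * f t) = F s"
    "\<And>s. Re s \<ge> 0 \<Longrightarrow> integrable lborel (\<lambda>t. exp (- of_real t * s) * f t)"
    using L1_tfD[OF assms(1)] by blast
  obtain g where g: "integrable lborel g" "\<forall>t<0. g t = 0" "(LINT t|lborel. norm (g t)) \<le> d"
    "\<And>s. Re s \<ge> 0 \<Longrightarrow> (LINT t|lborel. exp (- of_real t * s) * g t) = G s"
    "\<And>s. Re s \<ge> 0 \<Longrightarrow> integrable lborel (\<lambda>t. exp (- of_real t * s) * g t)"
    using L1_tfD[OF assms(2)] by blast
  show ?thesis
  proof (rule L1_tfI[of "\<lambda>t. f t + g t"])
    have "(LINT t|lborel. norm (f t + g t)) \<le> (LINT t|lborel. norm (f t) + norm (g t))"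
      using f(1) g(1) by (intro integral_mono) (auto intro: norm_triangle_ineq)
    then show "(LINT t|lborel. norm (f t + g t)) \<le> c + d"
      using f(1,3) g(1,3) by simp
  qed (use f g in \<open>auto simp: distrib_left\<close>)
qed

lemma L1_tf_cmult:
  assumes "L1_tf G c"
  shows "L1_tf (\<lambda>s. a * G s) (norm a * c)"
proof -
  obtain g where g: "integrable lborel g" "\<forall>t<0. g t = 0" "(LINT t|lborel. norm (g t)) \<le> c"
    "\<And>s. Re s \<ge> 0 \<Longrightarrow> (LINT t|lborel. exp (- of_real t * s) * g t) = G s"
    "\<And>s. Re s \<ge> 0 \<Longrightarrow> integrable lborel (\<lambda>t. exp (- of_real t * s) * g t)"
    using L1_tfD[OF assms] by blast
  show ?thesis
  proof (rule L1_tfI[of "\<lambda>t. a * g t"])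
    show "(LINT t|lborel. norm (a * g t)) \<le> norm a * c"
      using g(3) by (simp add: norm_mult mult_left_mono)
    show "(LINT t|lborel. exp (- of_real t * s) * (a * g t)) = a * G s" if "Re s \<ge> 0" for s
      using g(4)[OF that] by (simp add: mult.left_commute)
  qed (use g in auto)
qed

lemma L1_tf_sum:
  assumes "\<And>i. i \<in> I \<Longrightarrow> L1_tf (G i) (c i)"
  shows "L1_tf (\<lambda>s. \<Sum>i\<in>I. G i s) (\<Sum>i\<in>I. c i)"
  using assms
proof (induction I rule: infinite_finite_induct)
  case (insert i I)
  then show ?case by (simp add: L1_tf_add)
qed (simp_all add: L1_tf_zero)

text \<open>A delay translates the response to the right: it stays causal because
  \<open>\<tau> \<ge> 0\<close>, and translation invariance keeps the bound unchanged.\<close>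

lemma L1_tf_delay:
  assumes "L1_tf G c" "\<tau> \<ge> 0"
  shows "L1_tf (\<lambda>s. exp (- of_real \<tau> * s) * G s) c"
proof -
  obtain g where g: "integrable lborel g" "\<forall>t<0. g t = 0" "(LINT t|lborel. norm (g t)) \<le> c"
    "\<And>s. Re s \<ge> 0 \<Longrightarrow> (LINT t|lborel. exp (- of_real t * s) * g t) = G s"
    "\<And>s. Re s \<ge> 0 \<Longrightarrow> integrable lborel (\<lambda>t. exp (- of_real t * s) * g t)"
    using L1_tfD[OF assms(1)] by blast
  show ?thesis
  proof (rule L1_tfI[of "\<lambda>t. g (t - \<tau>)"])
    show "integrable lborel (\<lambda>t. g (t - \<tau>))"
      using lborel_integrable_real_affine[OF g(1), of 1 "-\<tau>"] by simp
    show "(LINT t|lborel. norm (g (t - \<tau>))) \<le> c"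
      using g(3) lborel_integral_real_affine[of 1 "\<lambda>t. norm (g t)" "-\<tau>"] by simp
    fix s :: complex assume s: "Re s \<ge> 0"
    have "(LINT t|lborel. exp (- of_real t * s) * g (t - \<tau>)) =
        (LINT t|lborel. exp (- of_real \<tau> * s) * (exp (- of_real t * s) * g t))"
      using lborel_integral_real_affine[of 1 "\<lambda>t. exp (- of_real t * s) * g (t - \<tau>)" "\<tau>"]
      by (simp add: left_diff_distrib exp_diff exp_minus divide_inverse mult.assoc mult.left_commute)
    then show "(LINT t|lborel. exp (- of_real t * s) * g (t - \<tau>)) = exp (- of_real \<tau> * s) * G s"
      using g(4)[OF s] by simp
  qed (use g assms(2) in auto)
qed

text \<open>For fixed \<open>u\<close>, integrating the norm over \<open>t\<close> gives
  \<open>norm (g u)\<close> times a constant, by translation invariance. This joint integrability is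
  what permits exchanging the order of integration for convolutions.\<close>

lemma integrable_convolution_kernel:
  fixes f g :: "real \<Rightarrow> complex"
  assumes "integrable lborel f" "integrable lborel g"
  shows "integrable (lborel \<Otimes>\<^sub>M lborel) (\<lambda>(u, t). f (t - u) * g u)"
proof (rule lborel_pair.Fubini_integrable)
  have [measurable]: "f \<in> borel_measurable borel" "g \<in> borel_measurable borel"
    using assms[THEN borel_measurable_integrable] by simp_all
  show "(\<lambda>(u, t). f (t - u) * g u) \<in> borel_measurable (lborel \<Otimes>\<^sub>M lborel)"
    by measurable
  have shift: "integrable lborel (\<lambda>t. f (t - u))" for u
    using lborel_integrable_real_affine[OF assms(1), of 1 "-u"] by simp
  then show "AE u in lborel. integrable lborel (\<lambda>t. case (u, t) of (u, t) \<Rightarrow> f (t - u) * g u)"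
    by simp
  have "(LINT t|lborel. norm (f (t - u))) = (LINT t|lborel. norm (f t))" for u
    using lborel_integral_real_affine[of 1 "\<lambda>t. norm (f t)" "-u"] by simp
  then show "integrable lborel (\<lambda>u. LINT t|lborel. norm (case (u, t) of (u, t) \<Rightarrow> f (t - u) * g u))"
    using assms(2) by (simp add: norm_mult)
qed

text \<open>Products correspond to convolutions \<open>h\<close>, and the bound is Young's
  inequality in its simplest case, with both exchanges of integrals justified by Fubini.\<close>

lemma L1_tf_mult:
  assumes "L1_tf F c" "L1_tf G d"
  shows "L1_tf (\<lambda>s. F s * G s) (c * d)"
proof -
  obtain f where f: "integrable lborel f" "\<forall>t<0. f t = 0" "(LINT t|lborel. norm (f t)) \<le> c"
    "\<And>s. Re s \<ge> 0 \<Longrightarrow> (LINT t|lborel. exp (- of_real t * s) * f t) = F s"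
    "\<And>s. Re s \<ge> 0 \<Longrightarrow> integrable lborel (\<lambda>t. exp (- of_real t * s) * f t)"
    using L1_tfD[OF assms(1)] by blast
  obtain g where g: "integrable lborel g" "\<forall>t<0. g t = 0" "(LINT t|lborel. norm (g t)) \<le> d"
    "\<And>s. Re s \<ge> 0 \<Longrightarrow> (LINT t|lborel. exp (- of_real t * s) * g t) = G s"
    "\<And>s. Re s \<ge> 0 \<Longrightarrow> integrable lborel (\<lambda>t. exp (- of_real t * s) * g t)"
    using L1_tfD[OF assms(2)] by blast
  define h where "h t = (LINT u|lborel. f (t - u) * g u)" for t
  note conv = integrable_convolution_kernel[OF f(1) g(1)]
  have nconv: "integrable (lborel \<Otimes>\<^sub>M lborel) (\<lambda>(u, t). norm (f (t - u) * g u))"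
    using integrable_norm[OF conv] by (simp add: case_prod_unfold)
  show ?thesis
  proof (rule L1_tfI[of h])
    show int_h: "integrable lborel h"
      unfolding h_def using lborel_pair.integrable_snd[OF conv] by simp
    have zero: "f (t - u) * g u = 0" if "t < 0" for t u
      using f(2) g(2) that by (cases "u < 0") auto
    then show "h t = 0" if "t < 0" for t
      unfolding h_def zero[OF that] by simp
    have "(LINT t|lborel. norm (h t)) \<le> (LINT t|lborel. LINT u|lborel. norm (f (t - u) * g u))"
    proof (rule integral_mono)
      show "integrable lborel (\<lambda>t. LINT u|lborel. norm (f (t - u) * g u))"
        using lborel_pair.integrable_snd[OF nconv] by simp
      show "norm (h t) \<le> (LINT u|lborel. norm (f (t - u) * g u))" for t
        unfolding h_def by (rule integral_norm_bound)
    qed (rule integrable_norm[OF int_h])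
    also have "\<dots> = (LINT u|lborel. LINT t|lborel. norm (f (t - u) * g u))"
      using lborel_pair.Fubini_integral[OF nconv] by simp
    also have "\<dots> = (LINT t|lborel. norm (f t)) * (LINT u|lborel. norm (g u))"
      using lborel_integral_real_affine[of 1 "\<lambda>t. norm (f t)" "- u" for u] by (simp add: norm_mult)
    also have "\<dots> \<le> c * d"
      using f(3) g(3) L1_tf_nonneg[OF assms(1)] by (intro mult_mono) auto
    finally show "(LINT t|lborel. norm (h t)) \<le> c * d" .
    fix s :: complex assume s: "Re s \<ge> 0"
    define e where "e t = exp (- of_real t * s)" for t :: real
    \<comment> \<open>Multiplicativity of the kernel distributes it over the two factors, so the
      weighted convolution is the convolution of the weighted responses.\<close>
    have e: "e t * (x * y) = (e (t - u) * x) * (e u * y)" for t u x y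
      proof -
      have "e t = e (t - u) * e u"
        by (simp add: e_def exp_add[symmetric] left_diff_distrib)
      then show ?thesis by simp
    qed
    have conv': "integrable (lborel \<Otimes>\<^sub>M lborel) (\<lambda>(u, t). (e (t - u) * f (t - u)) * (e u * g u))"
      unfolding e_def by (intro integrable_convolution_kernel f(5) g(5) s)
    have "(LINT t|lborel. e t * h t) = (LINT t|lborel. LINT u|lborel. e t * (f (t - u) * g u))"
      unfolding h_def by simp
    also have "\<dots> = (LINT t|lborel. LINT u|lborel. (e (t - u) * f (t - u)) * (e u * g u))"
      by (intro Bochner_Integration.integral_cong refl e)
    also have "\<dots> = (LINT u|lborel. LINT t|lborel. (e (t - u) * f (t - u)) * (e u * g u))"
      using lborel_pair.Fubini_integral[OF conv'] by simp
    also have "\<dots> = (LINT t|lborel. e t * f t) * (LINT u|lborel. e u * g u)"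
      using lborel_integral_real_affine[of 1 "\<lambda>t. e t * f t" "- u" for u] by simp
    finally show "(LINT t|lborel. exp (- of_real t * s) * h t) = F s * G s"
      using f(4)[OF s] g(4)[OF s] by (simp add: e_def)
  qed
qed

text \<open>The summed norms have finite integral, so the series of responses converges absolutely
  almost everywhere. Its sum is integrable, and integration commutes with summation both with and
  without the Laplace kernel.\<close>

lemma L1_tf_suminf:
  assumes G: "\<And>n. L1_tf (G n) (c n)" and "summable c"
  shows "L1_tf (\<lambda>s. \<Sum>n. G n s) (\<Sum>n. c n)"
proof -
  have "\<exists>g. \<forall>n. integrable lborel (g n) \<and> (\<forall>t<0. g n t = 0) \<and> (LINT t|lborel. norm (g n t)) \<le> c n \<and>
     (\<forall>s. Re s \<ge> 0 \<longrightarrow> (LINT t|lborel. exp (- of_real t * s) * g n t) = G n s)"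
    using G unfolding L1_tf_def by (intro choice) blast
  then obtain g where g: "\<And>n. integrable lborel (g n)" "\<And>n. \<forall>t<0. g n t = 0"
      "\<And>n. (LINT t|lborel. norm (g n t)) \<le> c n"
      "\<And>n s. Re s \<ge> 0 \<Longrightarrow> (LINT t|lborel. exp (- of_real t * s) * g n t) = G n s"
    by blast
  have sm: "summable (\<lambda>n. LINT t|lborel. norm (g n t))"
    using g(3) by (intro summable_comparison_test'[OF \<open>summable c\<close>, of 0]) auto
  \<comment> \<open>Working first in the extended nonnegative reals needs no convergence hypothesis;
    finiteness of the integral then yields pointwise summability almost everywhere.\<close>
  have "(\<integral>\<^sup>+t. (\<Sum>n. ennreal (norm (g n t))) \<partial>lborel) = (\<Sum>n. \<integral>\<^sup>+t. ennreal (norm (g n t)) \<partial>lborel)"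
    using g(1)[THEN borel_measurable_integrable] by (intro nn_integral_suminf) auto
  also have "\<dots> = (\<Sum>n. ennreal (LINT t|lborel. norm (g n t)))"
    using g(1) by (intro suminf_cong nn_integral_eq_integral) auto
  also have "\<dots> = ennreal (\<Sum>n. LINT t|lborel. norm (g n t))"
    using sm by (intro suminf_ennreal2) auto
  also have "\<dots> < \<infinity>" by simp
  finally have fin: "(\<integral>\<^sup>+t. (\<Sum>n. ennreal (norm (g n t))) \<partial>lborel) \<noteq> \<infinity>" by simp
  have "AE t in lborel. (\<Sum>n. ennreal (norm (g n t))) \<noteq> \<infinity>"
    using g(1)[THEN borel_measurable_integrable] fin by (intro nn_integral_noteq_infinite) auto
  then have ae: "AE t in lborel. summable (\<lambda>n. norm (g n t))"
    by eventually_elim (auto intro!: summable_suminf_not_top)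
  show ?thesis
  proof (rule L1_tfI[of "\<lambda>t. \<Sum>n. g n t"])
    show "integrable lborel (\<lambda>t. \<Sum>n. g n t)"
      using integrable_suminf[OF g(1) ae sm] .
    have "(LINT t|lborel. norm (\<Sum>n. g n t)) \<le> (LINT t|lborel. (\<Sum>n. norm (g n t)))"
    proof (rule integral_mono_AE)
      show "integrable lborel (\<lambda>t. norm (\<Sum>n. g n t))"
        using integrable_suminf[OF g(1) ae sm] by (rule integrable_norm)
      show "integrable lborel (\<lambda>t. \<Sum>n. norm (g n t))"
        using g(1) ae sm by (intro integrable_suminf) auto
      show "AE t in lborel. norm (\<Sum>n. g n t) \<le> (\<Sum>n. norm (g n t))"
        using ae by eventually_elim (rule summable_norm)
    qed
    also have "\<dots> = (\<Sum>n. LINT t|lborel. norm (g n t))"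
      using g(1) ae sm by (intro integral_suminf) auto
    also have "\<dots> \<le> (\<Sum>n. c n)"
      using g(3) sm \<open>summable c\<close> by (intro suminf_le) auto
    finally show "(LINT t|lborel. norm (\<Sum>n. g n t)) \<le> (\<Sum>n. c n)" .
    fix s :: complex assume s: "Re s \<ge> 0"
    note int = laplace_integrable[OF g(1,2) s]
    have bd: "norm (exp (- of_real t * s) * g n t) \<le> norm (g n t)" for n t
      by (rule norm_laplace_kernel_le[OF g(2) s])
    have ae': "AE t in lborel. summable (\<lambda>n. norm (exp (- of_real t * s) * g n t))"
      using ae
    proof eventually_elim
      case (elim t)
      show ?case by (rule summable_comparison_test'[OF elim, of 0]) (use bd in simp)
    qed
    have sm': "summable (\<lambda>n. LINT t|lborel. norm (exp (- of_real t * s) * g n t))"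
    proof (rule summable_comparison_test'[OF sm, of 0])
      show "norm (LINT t|lborel. norm (exp (- of_real t * s) * g n t)) \<le> (LINT t|lborel. norm (g n t))" for n
        using bd int g(1) by (simp, intro integral_mono integrable_norm) auto
    qed
    have "(LINT t|lborel. exp (- of_real t * s) * (\<Sum>n. g n t)) =
        (LINT t|lborel. (\<Sum>n. exp (- of_real t * s) * g n t))"
    proof (rule integral_cong_AE)
      show "AE t in lborel. exp (- of_real t * s) * (\<Sum>n. g n t) = (\<Sum>n. exp (- of_real t * s) * g n t)"
        using ae by eventually_elim (auto intro!: suminf_mult[symmetric] dest: summable_norm_cancel)
      show "(\<lambda>t. exp (- of_real t * s) * (\<Sum>n. g n t)) \<in> borel_measurable lborel"
        using integrable_suminf[OF g(1) ae sm, THEN borel_measurable_integrable]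
        by measurable
      show "(\<lambda>t. \<Sum>n. exp (- of_real t * s) * g n t) \<in> borel_measurable lborel"
        using integrable_suminf[OF int ae' sm'] by (rule borel_measurable_integrable)
    qed
    also have "\<dots> = (\<Sum>n. LINT t|lborel. exp (- of_real t * s) * g n t)"
      by (rule integral_suminf[OF int ae' sm'])
    finally show "(LINT t|lborel. exp (- of_real t * s) * (\<Sum>n. g n t)) = (\<Sum>n. G n s)"
      using g(4)[OF s] by simp
  qed (use g(2) in auto)
qed

text \<open>Powers start at 1 because the constant 1 is the transform of a Dirac mass, which has no
  integrable density.\<close>

lemma L1_tf_power:
  assumes "L1_tf G c"
  shows "L1_tf (\<lambda>s. G s ^ Suc n) (c ^ Suc n)"
proof (induction n)
  case (Suc n)
  then show ?case using L1_tf_mult[OF assms Suc] by simp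
qed (use assms in simp)

text \<open>Alternating geometric series. The numerator \<open>D s\<close> removes the zeroth term,
  which would be the constant 1; the norms then sum to \<open>c / (1 - c)\<close>.\<close>

lemma L1_tf_neumann:
  assumes D: "L1_tf D c" and "c < 1"
  shows "L1_tf (\<lambda>s. D s / (1 + D s)) (c / (1 - c))"
proof -
  have c0: "0 \<le> c" using L1_tf_nonneg[OF D] .
  have "L1_tf (\<lambda>s. (-1) ^ n * D s ^ Suc n) (c ^ Suc n)" for n
    using L1_tf_cmult[OF L1_tf_power[OF D, of n], of "(-1) ^ n"] by (simp add: norm_power)
  moreover have *: "(\<lambda>n. c ^ Suc n) sums (c / (1 - c))"
    using sums_mult[OF geometric_sums[of c], of c] c0 \<open>c < 1\<close> by simp
  ultimately have "L1_tf (\<lambda>s. \<Sum>n. (-1) ^ n * D s ^ Suc n) (\<Sum>n. c ^ Suc n)"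
    by (intro L1_tf_suminf) (auto simp: sums_iff)
  then show ?thesis
  proof (rule L1_tf_weaken)
    fix s :: complex assume "Re s \<ge> 0"
    then have "norm (- D s) < 1"
      using L1_tf_norm_le[OF D] \<open>c < 1\<close> by force
    from sums_mult[OF geometric_sums[OF this], of "D s"]
    show "(\<Sum>n. (-1) ^ n * D s ^ Suc n) = D s / (1 + D s)"
      by (simp add: sums_iff power_minus[of "D s"] mult_ac)
  qed (use * in \<open>simp add: sums_iff\<close>)
qed

section \<open>Poles and delays\<close>

text \<open>The response is \<open>exp (a * t)\<close> on the half-line, whose modulus
  \<open>exp (Re a * t)\<close> has integral \<open>1 / - Re a\<close>.\<close>

lemma L1_tf_pole:
  assumes a: "Re a < 0"
  shows "L1_tf (\<lambda>s. 1 / (s - a)) (1 / - Re a)"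
proof (rule L1_tfI[of "\<lambda>t. indicator {0..} t *\<^sub>R exp (of_real t * a)"])
  define r where "r = - Re a"
  have r: "r > 0" using a by (simp add: r_def)
  \<comment> \<open>The nonnegative integral of the modulus provides its value and, at the same
    time, the integrable majorant for all transforms below.\<close>
  have "((\<lambda>x. - exp (- (r * x)) / r) \<longlongrightarrow> - 0 / r) at_top"
    using r by (intro tendsto_intros filterlim_compose[OF exp_at_bot] filterlim_compose[OF filterlim_uminus_at_bot_at_top]
        filterlim_tendsto_pos_mult_at_top[OF tendsto_const _ filterlim_ident]) auto
  then have "(\<integral>\<^sup>+x. ennreal (exp (- (r * x))) * indicator {0..} x \<partial>lborel) = ennreal (0 - - exp (- (r * 0)) / r)"
    using r by (intro nn_integral_FTC_atLeast) (auto intro!: derivative_eq_intros)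
  then have "(\<integral>\<^sup>+x. ennreal (indicator {0..} x *\<^sub>R exp (- (r * x))) \<partial>lborel) = ennreal (1 / r)"
    by (simp add: ennreal_mult ennreal_indicator mult.commute)
  then have real_int: "has_bochner_integral lborel (\<lambda>x. indicator {0..} x *\<^sub>R exp (- (r * x))) (1 / r)"
    using r by (intro has_bochner_integral_nn_integral) auto
  have norm_eq: "norm (indicator {0..} t *\<^sub>R exp (of_real t * a)) = indicator {0..} t *\<^sub>R exp (- (r * t))" for t
    by (simp add: r_def mult.commute)
  show "(LINT t|lborel. norm (indicator {0..} t *\<^sub>R exp (of_real t * a))) \<le> 1 / - Re a"
    using real_int unfolding norm_eq by (simp add: has_bochner_integral_iff r_def)
  have int: "set_integrable lborel {0..} (\<lambda>t. exp (of_real t * (a - s)))" if "Re s \<ge> 0" for s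
  proof -
    show ?thesis
      unfolding set_integrable_def
    proof (rule Bochner_Integration.integrable_bound[of _ "\<lambda>t. indicator {0..} t *\<^sub>R exp (- (r * t))"])
      show "integrable lborel (\<lambda>t. indicator {0..} t *\<^sub>R exp (- (r * t)))"
        using real_int by (simp add: has_bochner_integral_iff)
      show "(\<lambda>t. indicator {0..} t *\<^sub>R exp (of_real t * (a - s))) \<in> borel_measurable lborel"
        using laplace_kernel_measurable[of "s - a"] by (simp add: right_diff_distrib)
    qed (use that in \<open>auto simp: r_def mult_nonneg_nonneg right_diff_distrib split: split_indicator\<close>)
  qed
  show "integrable lborel (\<lambda>t. indicator {0..} t *\<^sub>R exp (of_real t * a))"
    using int[of 0] by (simp add: set_integrable_def)
  fix s :: complex assume s: "Re s \<ge> 0"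
  define F where "F t = exp (of_real t * (a - s)) / (a - s)" for t
  have ne: "a - s \<noteq> 0" using a s by auto
  have "(LBINT t=0..\<infinity>. exp (of_real t * (a - s))) = 0 - F 0"
  proof (rule interval_integral_FTC_integrable)
    show "(F has_vector_derivative exp (of_real t * (a - s))) (at t)" for t
      unfolding F_def using ne by (auto intro!: derivative_eq_intros has_vector_derivative_real_field)
    show "set_integrable lborel (einterval 0 \<infinity>) (\<lambda>t. exp (of_real t * (a - s)))"
      using set_integrable_subset[OF int[OF s], of "{0<..}"] by (simp add: einterval_def greaterThan_def[symmetric] subset_iff)
    have "isCont F 0" unfolding F_def by (intro continuous_intros ne)
    then show "((F \<circ> real_of_ereal) \<longlongrightarrow> F 0) (at_right 0)"
      by (simp add: zero_ereal_def ereal_tendsto_simps isCont_def filterlim_at_split)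
    have "((\<lambda>t. exp (- (r + Re s) * t) / norm (a - s)) \<longlongrightarrow> 0 / norm (a - s)) at_top"
      using r s ne
      by (intro tendsto_intros filterlim_compose[OF exp_at_bot]
          filterlim_tendsto_neg_mult_at_bot[OF tendsto_const _ filterlim_ident]) auto
    then have "(F \<longlongrightarrow> 0) at_top"
      by (intro tendsto_norm_zero_cancel[of F]) (simp add: F_def norm_divide r_def algebra_simps)
    then show "((F \<circ> real_of_ereal) \<longlongrightarrow> 0) (at_left \<infinity>)"
      by (simp add: ereal_tendsto_simps)
  qed auto
  moreover have "0 - F 0 = 1 / (s - a)"
    by (simp add: F_def minus_divide_right)
  ultimately have "(LINT t:{0<..}|lborel. exp (of_real t * (a - s))) = 1 / (s - a)"
    by (simp add: interval_lebesgue_integral_0_infty)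
  \<comment> \<open>The interval integral lives on the open half-line; adding the endpoint 0 changes
    only a null set.\<close>
  moreover have "(LINT t:{0<..}|lborel. exp (of_real t * (a - s))) = (LINT t:{0..}|lborel. exp (of_real t * (a - s)))"
    using AE_lborel_singleton[of 0] int[OF s] set_integrable_subset[OF int[OF s], of "{0<..}"]
    by (intro set_integral_cong_set)
      (auto simp: set_integrable_def set_borel_measurable_def dest: borel_measurable_integrable elim: eventually_mono)
  moreover have "exp (- of_real t * s) * (indicator {0..} t *\<^sub>R exp (of_real t * a)) =
     indicator {0..} t *\<^sub>R exp (of_real t * (a - s))" for t :: real
    by (simp add: exp_add[symmetric] algebra_simps)
  ultimately show "(LINT t|lborel. exp (- of_real t * s) * (indicator {0..} t *\<^sub>R exp (of_real t * a))) = 1 / (s - a)"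
    unfolding set_lebesgue_integral_def by (simp only:)
qed auto

text \<open>The response is the indicator of \<open>{0..\<rho>}\<close>. The separate value at
  \<open>s = 0\<close> fills the removable singularity of the quotient.\<close>

lemma L1_tf_window:
  assumes "\<rho> \<ge> 0"
  shows "L1_tf (\<lambda>s. if s = 0 then of_real \<rho> else (1 - exp (- of_real \<rho> * s)) / s) \<rho>"
proof (rule L1_tfI[of "\<lambda>t. indicator {0..\<rho>} t *\<^sub>R 1"])
  show "integrable lborel (\<lambda>t. indicator {0..\<rho>} t *\<^sub>R (1::complex))"
    using assms by (intro integrable_scaleR_left impI integrable_real_indicator) auto
  show "(LINT t|lborel. norm (indicator {0..\<rho>} t *\<^sub>R (1::complex))) \<le> \<rho>"
    using assms by simp
  fix s :: complex
  have *: "exp (- of_real t * s) * (indicator {0..\<rho>} t *\<^sub>R 1) =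
      indicator {0..\<rho>} t *\<^sub>R exp (- of_real t * s)" for t
    by simp
  show "(LINT t|lborel. exp (- of_real t * s) * (indicator {0..\<rho>} t *\<^sub>R 1)) =
    (if s = 0 then of_real \<rho> else (1 - exp (- of_real \<rho> * s)) / s)"
  proof (cases "s = 0")
    case True
    then show ?thesis using assms by (simp add: scaleR_conv_of_real)
  next
    case False
    have "(LINT t|lborel. indicator {0..\<rho>} t *\<^sub>R exp (- of_real t * s)) =
       - exp (- of_real \<rho> * s) / s - (- exp (- of_real 0 * s) / s)"
      by (rule integral_FTC_atLeastAtMost[OF assms])
        (use False in \<open>auto intro!: derivative_eq_intros has_vector_derivative_real_field continuous_intros\<close>)
    then show ?thesis unfolding * using False by (simp add: diff_divide_distrib)
  qed
qed (use assms in auto)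

section \<open>The low-pass filter \<open>K\<close> and differences of delays\<close>

definition lag :: "real \<Rightarrow> complex \<Rightarrow> complex" where
  "lag k s = of_real k / (s + of_real k)"

lemma L1_tf_lag:
  assumes "k > 0"
  shows "L1_tf (lag k) 1"
  using L1_tf_cmult[OF L1_tf_pole[of "- of_real k"], of "of_real k"] assms
  by (simp add: lag_def[abs_def])

lemma lag_denominator_nonzero:
  assumes "k > 0" "Re s \<ge> 0"
  shows "s + of_real k \<noteq> 0"
  using assms by (auto simp: complex_eq_iff)

text \<open>Write \<open>1 - exp (- \<rho> s)\<close> as \<open>s * J s\<close> with
  \<open>J\<close> the window transform. Since \<open>lag k s * s = k - k * lag k s\<close>, the
  factor \<open>s\<close> is absorbed by the filter; the two resulting terms contribute
  \<open>k * \<rho>\<close> each.\<close>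

lemma L1_tf_lag_difference:
  assumes "k > 0" "\<rho> \<ge> 0"
  shows "L1_tf (\<lambda>s. lag k s * (1 - exp (- of_real \<rho> * s))) (2 * k * \<rho>)"
proof -
  define J where "J s = (if s = 0 then of_real \<rho> else (1 - exp (- of_real \<rho> * s)) / s)" for s :: complex
  have J: "L1_tf J \<rho>"
    unfolding J_def[abs_def] using L1_tf_window[OF assms(2)] by simp
  have "L1_tf (\<lambda>s. of_real k * J s + - of_real k * (lag k s * J s)) (k * \<rho> + k * \<rho>)"
    using L1_tf_add[OF L1_tf_cmult[OF J] L1_tf_cmult[OF L1_tf_mult[OF L1_tf_lag[OF assms(1)] J]],
        of "of_real k" "- of_real k"] assms(1) by simp
  then show ?thesis
  proof (rule L1_tf_weaken)
    fix s :: complex assume "Re s \<ge> 0"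
    then have ne: "s + of_real k \<noteq> 0" by (rule lag_denominator_nonzero[OF assms(1)])
    have "s * J s = 1 - exp (- of_real \<rho> * s)" by (simp add: J_def)
    moreover have "of_real k - of_real k * lag k s = lag k s * s"
      using ne by (simp add: lag_def divide_simps) (simp add: algebra_simps)
    ultimately show "of_real k * J s + - of_real k * (lag k s * J s) =
        lag k s * (1 - exp (- of_real \<rho> * s))"
      by (metis (no_types, lifting) ab_group_add_class.ab_diff_conv_add_uminus left_diff_distrib mult.assoc mult_minus_left)
  qed simp
qed

text \<open>Factoring out the smaller delay, which costs nothing, leaves the previous estimate with
  \<open>\<rho>\<close> the difference of the delays; the other order follows by a change of
  sign.\<close>

lemma L1_tf_delay_difference:
  assumes "k > 0" "\<tau> \<ge> 0" "\<tau>' \<ge> 0"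
  shows "L1_tf (\<lambda>s. lag k s * (exp (- of_real \<tau> * s) - exp (- of_real \<tau>' * s))) (2 * k * \<bar>\<tau> - \<tau>'\<bar>)"
  using assms(2,3)
proof (induction \<tau> \<tau>' rule: linorder_wlog)
  case (le \<tau> \<tau>')
  have "exp (- of_real \<tau> * s) * (lag k s * (1 - exp (- of_real (\<tau>' - \<tau>) * s))) =
      lag k s * (exp (- of_real \<tau> * s) - exp (- of_real \<tau>' * s))" for s :: complex
    by (simp add: algebra_simps exp_add[symmetric])
  with L1_tf_delay[OF L1_tf_lag_difference[OF assms(1), of "\<tau>' - \<tau>"], of \<tau>] le show ?case
    by (simp only: diff_ge_0_iff_ge) simp
next
  case (sym \<tau> \<tau>')
  then show ?case
    using L1_tf_cmult[of _ _ "-1"] by (fastforce simp: algebra_simps abs_minus_commute)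
qed

section \<open>The resolvent of a stable matrix\<close>

text \<open>This is \<open>p(M) v\<close>, evaluated by Horner's scheme on vectors, so that no
  powers of matrices have to be formed.\<close>

definition poly_mat_vec :: "complex^'n^'n \<Rightarrow> complex poly \<Rightarrow> complex^'n \<Rightarrow> complex^'n" where
  "poly_mat_vec M p v = fold_coeffs (\<lambda>c w. c *s v + M *v w) p 0"

lemma poly_mat_vec_0 [simp]: "poly_mat_vec M 0 v = 0"
  by (simp add: poly_mat_vec_def)

lemma poly_mat_vec_pCons [simp]:
  "poly_mat_vec M (pCons c p) v = c *s v + M *v poly_mat_vec M p v"
  by (cases "p = 0 \<and> c = 0") (auto simp: poly_mat_vec_def)

lemma poly_mat_vec_add: "poly_mat_vec M (p + q) v = poly_mat_vec M p v + poly_mat_vec M q v"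
  by (induction p q rule: poly_induct2) (simp_all add: vec.add vec.scale_left_distrib algebra_simps)

lemma poly_mat_vec_smult: "poly_mat_vec M (smult c p) v = c *s poly_mat_vec M p v"
  by (induction p) (simp_all add: vec.scale vec.scale_right_distrib)

lemma poly_mat_vec_diff: "poly_mat_vec M (p - q) v = poly_mat_vec M p v - poly_mat_vec M q v"
  using poly_mat_vec_add[of M p "- q" v] poly_mat_vec_smult[of M "-1" q v] by simp

lemma poly_mat_vec_commute: "poly_mat_vec M p (M *v v) = M *v poly_mat_vec M p v"
  by (induction p) (simp_all add: vec.add vec.scale)

lemma poly_mat_vec_minus_right:
  "poly_mat_vec M p (v - a *s w) = poly_mat_vec M p v - a *s poly_mat_vec M p w"
proof (induction p)
  case (pCons c p)
  show ?case
    unfolding poly_mat_vec_pCons pCons.IH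
    by (simp add: vec.scale vec.diff vec.scale_right_distrib vec.scale_right_diff_distrib vec.scale_left_commute[of c])
qed simp

lemma poly_mat_vec_root:
  "poly_mat_vec M ([:- a, 1:] * q) v = M *v poly_mat_vec M q v - a *s poly_mat_vec M q v"
  by (simp add: poly_mat_vec_diff poly_mat_vec_smult)

lemma poly_mat_vec_monom: "poly_mat_vec M (monom c k) v = c *s ((*v) M ^^ k) v"
  by (induction k) (simp_all add: monom_0 monom_Suc vec.scale)

text \<open>The degree bound makes \<open>monom 1 k - p\<close> nonzero later. The alternative
  \<open>p = 0\<close> is needed for \<open>k = 0\<close>, where the span is trivial and no degree
  is below \<open>k\<close>.\<close>

lemma span_powers_poly:
  assumes "w \<in> vec.span ((\<lambda>j. ((*v) M ^^ j) v) ` {..<k})"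
  shows "\<exists>p. (p = 0 \<or> degree p < k) \<and> w = poly_mat_vec M p v"
  using assms
proof (induction rule: vec.span_induct_alt)
  case base
  then show ?case by (intro exI[of _ 0]) simp
next
  case (step c x y)
  then obtain p j where p: "p = 0 \<or> degree p < k" "y = poly_mat_vec M p v" "j < k" "x = ((*v) M ^^ j) v"
    by auto
  have "degree (monom c j + p) < k"
    using p degree_monom_le[of c j] by (intro degree_add_less) auto
  then show ?case
    using p by (intro exI[of _ "monom c j + p"]) (simp add: poly_mat_vec_add poly_mat_vec_monom)
qed

text \<open>In finite dimension the iterates \<open>v, M v, M (M v), ...\<close> cannot all be
  independent. An iterate in the span of its predecessors gives a monic polynomial that annihilates
  \<open>v\<close>.\<close>

lemma annihilating_poly_exists:
  fixes M :: "complex^'n^'n"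
  shows "\<exists>p. p \<noteq> 0 \<and> poly_mat_vec M p v = 0"
proof -
  let ?x = "\<lambda>j. ((*v) M ^^ j) v"
  have "\<exists>k. ?x k \<in> vec.span (?x ` {..<k})"
  proof (rule ccontr)
    assume "\<nexists>k. ?x k \<in> vec.span (?x ` {..<k})"
    then have *: "?x k \<notin> vec.span (?x ` {..<k})" for k by blast
    have ind: "vec.independent (?x ` {..<k}) \<and> card (?x ` {..<k}) = k" for k
    proof (induction k)
      case (Suc k)
      have "?x k \<notin> ?x ` {..<k}" using *[of k] vec.span_base[of "?x k" "?x ` {..<k}"] by argo
      moreover have "vec.independent (insert (?x k) (?x ` {..<k}))"
        using Suc *[of k] by (intro vec.independent_insertI) auto
      ultimately show ?case using Suc by (simp add: lessThan_Suc)
    qed (simp add: vec.independent_empty)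
    have "card (?x ` {..<k}) \<le> vec.dim (UNIV :: (complex^'n) set)" for k
      using ind[of k] by (intro vec.independent_card_le_dim) auto
    from this[of "Suc (vec.dim (UNIV :: (complex^'n) set))"]
      conjunct2[OF ind[of "Suc (vec.dim (UNIV :: (complex^'n) set))"]] show False
      by linarith
  qed
  then obtain k where "?x k \<in> vec.span (?x ` {..<k})" ..
  from span_powers_poly[OF this] obtain p
    where p: "p = 0 \<or> degree p < k" "?x k = poly_mat_vec M p v" by blast
  have "coeff (monom 1 k - p) k \<noteq> 0"
    using p(1) by (auto simp: coeff_eq_0)
  then have "monom 1 k - p \<noteq> 0" by auto
  moreover have "poly_mat_vec M (monom 1 k - p) v = 0"
    using p(2) by (simp add: poly_mat_vec_diff poly_mat_vec_monom)
  ultimately show ?thesis by blast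
qed

section \<open>The resolvent on the closed right half-plane\<close>

definition resolvent :: "complex^'n^'n \<Rightarrow> complex \<Rightarrow> complex^'n \<Rightarrow> complex^'n" where
  "resolvent M s v = matrix_inv (mat s - M) *v v"

lemma mat_mult_vec: "mat s *v v = s *s (v :: complex^'n)"
  by (simp add: matrix_vector_mult_def mat_def vec_eq_iff mult_delta_left)

lemma matrix_inv_mult:
  fixes A :: "'a::semiring_1^'n^'m"
  assumes "invertible A"
  shows "A ** matrix_inv A = mat 1" "matrix_inv A ** A = mat 1"
  using someI_ex[OF assms[unfolded invertible_def]] unfolding matrix_inv_def by simp_all

context
  fixes M :: "complex^'n^'n"
  assumes stable: "\<And>s v. v \<noteq> 0 \<Longrightarrow> M *v v = s *s v \<Longrightarrow> Re s < 0"
begin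

text \<open>No \<open>s\<close> with \<open>Re s \<ge> 0\<close> is an eigenvalue, so
  \<open>mat s - M\<close> is injective and, being square, invertible.\<close>

lemma resolvent_inverse:
  assumes "Re s \<ge> 0"
  shows "s *s resolvent M s v - M *v resolvent M s v = v"
    and "resolvent M s (s *s v - M *v v) = v"
proof -
  have "inj ((*v) (mat s - M))"
  proof (rule injI)
    fix x y assume "(mat s - M) *v x = (mat s - M) *v y"
    then have "M *v (x - y) = s *s (x - y)"
      by (simp add: matrix_vector_mult_diff_rdistrib mat_mult_vec vec.diff vec.scale_right_diff_distrib algebra_simps)
    then show "x = y" using stable[of "x - y" s] assms by auto
  qed
  then have inv: "invertible (mat s - M)"
    by (simp add: invertible_left_inverse matrix_left_invertible_injective)
  have "(mat s - M) *v resolvent M s v = v"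
    unfolding resolvent_def by (simp add: matrix_vector_mul_assoc matrix_inv_mult(1)[OF inv])
  then show "s *s resolvent M s v - M *v resolvent M s v = v"
    by (simp add: matrix_vector_mult_diff_rdistrib mat_mult_vec)
  have "resolvent M s ((mat s - M) *v v) = v"
    unfolding resolvent_def by (simp add: matrix_vector_mul_assoc matrix_inv_mult(2)[OF inv])
  then show "resolvent M s (s *s v - M *v v) = v"
    by (simp add: matrix_vector_mult_diff_rdistrib mat_mult_vec)
qed

lemma resolvent_eqI:
  assumes "Re s \<ge> 0" "s *s x - M *v x = v"
  shows "resolvent M s v = x"
  using resolvent_inverse(2)[OF assms(1), of x] unfolding assms(2) .

text \<open>Apply the resolvent to \<open>(s - a) v = (s - M) v + (M - a) v\<close>. This splits off
  a simple pole at \<open>a\<close> and passes from \<open>v\<close> to \<open>(M - a) v\<close>,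
  which is annihilated by a polynomial with one factor fewer.\<close>

lemma resolvent_shift:
  assumes "Re s \<ge> 0" "s \<noteq> a"
  shows "resolvent M s v = (1 / (s - a)) *s (v + resolvent M s (M *v v - a *s v))"
proof (rule resolvent_eqI[OF assms(1)])
  let ?w = "resolvent M s (M *v v - a *s v)"
  have "s *s (v + ?w) - M *v (v + ?w) = (s *s v - M *v v) + (M *v v - a *s v)"
    using resolvent_inverse(1)[OF assms(1), of "M *v v - a *s v"]
    by (simp add: vec.add vec.scale_right_distrib algebra_simps)
  also have "\<dots> = (s - a) *s v"
    by (simp add: vec.scale_left_diff_distrib)
  finally have eq: "s *s (v + ?w) - M *v (v + ?w) = (s - a) *s v" .
  have "(1 / (s - a)) *s (s *s (v + ?w) - M *v (v + ?w)) = v"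
    unfolding eq vec.scale_scale using assms(2) by simp
  then show "s *s ((1 / (s - a)) *s (v + ?w)) - M *v ((1 / (s - a)) *s (v + ?w)) = v"
    by (simp only: vec.scale vec.scale_left_commute[of s] vec.scale_right_diff_distrib)
qed

text \<open>Induction on the degree of a polynomial \<open>p\<close> annihilating \<open>v\<close>: a root \<open>a\<close> of \<open>p\<close> with \<open>Re a < 0\<close> is
  peeled off by the lemma \<open>resolvent_shift\<close>; any other root is not an eigenvalue and can be cancelled.\<close>

lemma L1_tf_resolvent: "\<exists>c. L1_tf (\<lambda>s. resolvent M s v $ i) c"
proof -
  have "\<exists>c. L1_tf (\<lambda>s. resolvent M s v $ i) c" if "p \<noteq> 0" "poly_mat_vec M p v = 0" for p
    using that
  proof (induction "degree p" arbitrary: p v)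
    case 0
    then obtain c where "p = [:c:]" by (metis degree_eq_zeroE)
    with 0 have "v = 0" by simp
    then show ?case
      using L1_tf_zero by (auto simp: resolvent_def)
  next
    case (Suc n)
    have "\<not> constant (poly p)" using Suc.hyps(2) by (simp add: constant_degree)
    then obtain a where "poly p a = 0"
      using fundamental_theorem_of_algebra by blast
    then obtain q where q: "p = [:- a, 1:] * q" by (metis poly_eq_0_iff_dvd dvdE)
    have q0: "q \<noteq> 0" using Suc.prems q by auto
    then have deg: "n = degree q"
      using Suc.hyps(2) unfolding q by (subst (asm) degree_mult_eq) auto
    have 0: "M *v poly_mat_vec M q v = a *s poly_mat_vec M q v"
      using Suc.prems(2) unfolding q poly_mat_vec_root by simp
    show ?case
    proof (cases "Re a < 0")
      case False
      then have "poly_mat_vec M q v = 0" using stable[OF _ 0] by blast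
      then show ?thesis using Suc.hyps(1)[OF deg q0] by blast
    next
      case True
      have "poly_mat_vec M q (M *v v - a *s v) = 0"
        using 0 by (simp add: poly_mat_vec_minus_right poly_mat_vec_commute)
      then obtain c where c: "L1_tf (\<lambda>s. resolvent M s (M *v v - a *s v) $ i) c"
        using Suc.hyps(1)[OF deg q0] by blast
      note pole = L1_tf_pole[OF True]
      have "L1_tf (\<lambda>s. v $ i * (1 / (s - a)) + 1 / (s - a) * resolvent M s (M *v v - a *s v) $ i)
          (norm (v $ i) * (1 / - Re a) + (1 / - Re a) * c)"
        by (intro L1_tf_add L1_tf_cmult[OF pole] L1_tf_mult[OF pole c])
      then have "L1_tf (\<lambda>s. resolvent M s v $ i) (norm (v $ i) * (1 / - Re a) + (1 / - Re a) * c)"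
      proof (rule L1_tf_weaken)
        fix s :: complex assume s: "Re s \<ge> 0"
        then have "s \<noteq> a" using True by auto
        from resolvent_shift[OF s this, of v]
        show "v $ i * (1 / (s - a)) + 1 / (s - a) * resolvent M s (M *v v - a *s v) $ i = resolvent M s v $ i"
          by (simp add: algebra_simps)
      qed simp
      then show ?thesis by blast
    qed
  qed
  then show ?thesis using annihilating_poly_exists by blast
qed

end

section \<open>Uniqueness of impulse responses\<close>

text \<open>Open rays form an intersection-stable generator of the Borel sets. The sets on which
  \<open>w\<close> integrates to zero are closed under disjoint countable unions and, thanks to
  \<open>total\<close>, under complements; hence \<open>w\<close> and 0 have the same integral on
  every Borel set.\<close>

lemma AE_zero_if_integral_rays_zero:
  fixes w :: "real \<Rightarrow> real"
  assumes w: "integrable lborel w"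
    and rays: "\<And>r. (LINT t:{..<r}|lborel. w t) = 0"
    and total: "(LINT t|lborel. w t) = 0"
  shows "AE t in lborel. w t = 0"
proof (rule density_unique_real[where f' = "\<lambda>t. 0"])
  have wA: "set_integrable lborel A w" if "A \<in> sets borel" for A
    using integrable_mult_indicator[OF _ w, of A] that by (simp add: set_integrable_def)
  fix A :: "real set" assume "A \<in> sets lborel"
  then have A: "A \<in> sigma_sets UNIV (range (\<lambda>r. {..<r}))"
    by (simp add: borel_Iio)
  have Int: "Int_stable (range (\<lambda>r::real. {..<r}))"
  proof -
    have "{..<a} \<inter> {..<b} = {..<min a b}" for a b :: real by auto
    then show ?thesis by (auto simp: Int_stable_def)
  qed
  have sub: "range (\<lambda>r::real. {..<r}) \<subseteq> Pow UNIV" by simp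
  have borel: "B \<in> sigma_sets UNIV (range (\<lambda>r::real. {..<r})) \<longleftrightarrow> B \<in> sets borel" for B
    by (simp add: borel_Iio)
  have "(LINT t:A|lborel. w t) = 0"
    using Int sub A
  proof (induction rule: sigma_sets_induct_disjoint)
    case (compl A)
    then have "A \<in> sets borel" by (simp add: borel)
    have "(LINT t|lborel. w t) = (LINT t:A|lborel. w t) + (LINT t:(UNIV - A)|lborel. w t)"
      using set_integral_Un[of A "UNIV - A" lborel w] wA \<open>A \<in> sets borel\<close>
      by (simp add: set_lebesgue_integral_def)
    then show ?case using total compl by simp
  next
    case (union F)
    then have F: "F i \<in> sets borel" for i
      unfolding borel[symmetric] by (simp add: image_subset_iff)
    have "(LINT t:(\<Union>i. F i)|lborel. w t) = (\<Sum>i. LINT t:F i|lborel. w t)"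
      using union(1) F by (intro lebesgue_integral_countable_add wA) (auto simp: disjoint_family_on_def)
    then show ?case using union by simp
  qed (use rays in \<open>auto simp: set_lebesgue_integral_def\<close>)
  then show "(LINT t:A|lborel. w t) = (LINT t:A|lborel. 0)" by simp
qed (use w in auto)

text \<open>After the substitution \<open>x = exp (- t)\<close> the hypothesis says that all moments vanish, so the
  Weierstrass approximation theorem applies on \<open>{0..1}\<close>.\<close>

lemma AE_zero_if_laplace_zero_at_nat:
  fixes w :: "real \<Rightarrow> real"
  assumes w: "integrable lborel w" and supp: "\<And>t. t < 0 \<Longrightarrow> w t = 0"
    and zero: "\<And>n::nat. (LINT t|lborel. exp (- (real n * t)) * w t) = 0"
  shows "AE t in lborel. w t = 0"
proof -
  have [measurable]: "w \<in> borel_measurable borel"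
    using borel_measurable_integrable[OF w] by simp
  have supp': "w t = 0 \<or> exp (- t) \<in> {0..1}" for t
    using supp[of t] by (cases "t < 0") auto
  have int: "integrable lborel (\<lambda>t. p (exp (- t)) * w t)"
    if [measurable]: "p \<in> borel_measurable borel" and B: "\<And>x. x \<in> {0..1} \<Longrightarrow> \<bar>p x\<bar> \<le> B" for p :: "real \<Rightarrow> real" and B
  proof (rule Bochner_Integration.integrable_bound[of _ "\<lambda>t. B * w t"])
    show "AE t in lborel. norm (p (exp (- t)) * w t) \<le> norm (B * w t)"
    proof (rule AE_I2)
      fix t
      show "norm (p (exp (- t)) * w t) \<le> norm (B * w t)"
      proof (cases "w t = 0")
        case False
        then have "\<bar>p (exp (- t))\<bar> \<le> \<bar>B\<bar>"
          using supp'[of t] B[of "exp (- t)"] by linarith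
        then show ?thesis by (simp add: abs_mult mult_right_mono)
      qed simp
    qed
  qed (use w in auto)
  have poly: "(LINT t|lborel. p (exp (- t)) * w t) = 0" if p: "real_polynomial_function p" for p
  proof -
    obtain a n where pe: "p = (\<lambda>x. \<Sum>i\<le>n. a i * x ^ i)"
      using p real_polynomial_function_iff_sum by auto
    have "integrable lborel (\<lambda>t. exp (- t) ^ i * w t)" for i
      using int[of "\<lambda>x. x ^ i" 1] by (simp add: power_le_one)
    then have "(LINT t|lborel. (\<Sum>i\<le>n. a i * (exp (- t) ^ i * w t))) = (\<Sum>i\<le>n. a i * (LINT t|lborel. exp (- t) ^ i * w t))"
      by (subst Bochner_Integration.integral_sum) auto
    also have "\<dots> = 0"
      using zero by (simp add: exp_of_nat_mult[symmetric])
    finally show ?thesis by (simp add: pe sum_distrib_right mult.assoc)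
  qed
  have cont: "(LINT t|lborel. \<phi> (exp (- t)) * w t) = 0" if \<phi>: "continuous_on UNIV \<phi>" for \<phi>
  proof -
    have [measurable]: "\<phi> \<in> borel_measurable borel"
      using \<phi> by (rule borel_measurable_continuous_onI)
    have \<phi>': "continuous_on {0..1} \<phi>" using \<phi> by (rule continuous_on_subset) simp
    obtain B where "\<forall>y\<in>\<phi> ` {0..1}. norm y \<le> B"
      using compact_imp_bounded[OF compact_continuous_image[OF \<phi>' compact_Icc]]
      unfolding bounded_iff by blast
    then have B: "\<bar>\<phi> x\<bar> \<le> B" if "x \<in> {0..1}" for x
      using that by simp
    have "\<bar>LINT t|lborel. \<phi> (exp (- t)) * w t\<bar> \<le> e * (LINT t|lborel. \<bar>w t\<bar>)" if "e > 0" for e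
    proof -
      obtain p where p: "real_polynomial_function p" "\<And>x. x \<in> {0..1} \<Longrightarrow> \<bar>\<phi> x - p x\<bar> < e"
        using Stone_Weierstrass_real_polynomial_function[OF compact_Icc \<phi>' \<open>e > 0\<close>] by blast
      have [measurable]: "p \<in> borel_measurable borel"
        using p(1) by (intro borel_measurable_continuous_onI) (simp add: continuous_on_polymonial_function real_polynomial_function_eq)
      have pB: "\<bar>p x\<bar> \<le> B + e" if "x \<in> {0..1}" for x
        using B[OF that] p(2)[OF that] by linarith
      have ints: "integrable lborel (\<lambda>t. p (exp (- t)) * w t)" "integrable lborel (\<lambda>t. \<phi> (exp (- t)) * w t)"
        by (rule int[of p, OF _ pB] int[of \<phi>, OF _ B]; simp)+
      have "(LINT t|lborel. \<phi> (exp (- t)) * w t) = (LINT t|lborel. \<phi> (exp (- t)) * w t - p (exp (- t)) * w t)"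
        using ints poly[OF p(1)] by simp
      also have "\<bar>\<dots>\<bar> \<le> (LINT t|lborel. e * \<bar>w t\<bar>)"
      proof (rule order_trans[OF integral_abs_bound integral_mono])
        show "\<bar>\<phi> (exp (- t)) * w t - p (exp (- t)) * w t\<bar> \<le> e * \<bar>w t\<bar>" for t
        proof (cases "w t = 0")
          case False
          then have "\<bar>\<phi> (exp (- t)) - p (exp (- t))\<bar> \<le> e"
            using supp'[of t] p(2)[of "exp (- t)"] by linarith
          then show ?thesis by (simp add: left_diff_distrib[symmetric] abs_mult mult_right_mono)
        qed simp
      qed (use ints w in auto)
      finally show ?thesis by simp
    qed
    note bd = this
    \<comment> \<open>The previous bound is rescaled by \<open>?W + 1\<close> instead of
      \<open>?W\<close>, since \<open>?W\<close> may be zero.\<close>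
    have "\<bar>LINT t|lborel. \<phi> (exp (- t)) * w t\<bar> \<le> 0 + e" if "e > 0" for e
    proof -
      let ?W = "LINT t|lborel. \<bar>w t\<bar>"
      have W: "0 < ?W + 1" by (intro add_nonneg_pos) auto
      have "\<bar>LINT t|lborel. \<phi> (exp (- t)) * w t\<bar> \<le> e / (?W + 1) * ?W"
        using that W by (intro bd divide_pos_pos)
      also have "\<dots> \<le> e" using that W by (simp add: field_simps)
      finally show ?thesis by simp
    qed
    then have "\<bar>LINT t|lborel. \<phi> (exp (- t)) * w t\<bar> \<le> 0" by (rule field_le_epsilon)
    then show ?thesis by simp
  qed
  show ?thesis
  proof (rule AE_zero_if_integral_rays_zero[OF w])
    show "(LINT t|lborel. w t) = 0" using zero[of 0] by simp
    fix r :: real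
    \<comment> \<open>Continuous ramps in \<open>x = exp (- t)\<close> that converge to the
      indicator of \<open>x > exp (- r)\<close>, that is, of \<open>t < r\<close>; dominated
      convergence carries the vanishing integrals over to rays.\<close>
    define \<phi> where "\<phi> n x = min 1 (max 0 (real n * (x - exp (- r))))" for n :: nat and x
    have "(\<lambda>n. LINT t|lborel. \<phi> n (exp (- t)) * w t) \<longlonglongrightarrow> (LINT t|lborel. indicator {..<r} t *\<^sub>R w t)"
    proof (rule integral_dominated_convergence[where w = "\<lambda>t. \<bar>w t\<bar>"])
      show "AE t in lborel. (\<lambda>n. \<phi> n (exp (- t)) * w t) \<longlonglongrightarrow> indicator {..<r} t *\<^sub>R w t"
      proof (rule AE_I2)
        fix t :: real
        have "(\<lambda>n. \<phi> n (exp (- t))) \<longlonglongrightarrow> indicator {..<r} t"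
        proof (cases "t < r")
          case True
          then have d: "exp (- t) - exp (- r) > 0" by simp
          obtain N where N: "1 / (exp (- t) - exp (- r)) < real N" using reals_Archimedean2 by blast
          have "\<phi> n (exp (- t)) = 1" if "n \<ge> N" for n
          proof -
            have "1 < real N * (exp (- t) - exp (- r))" using N d by (simp add: field_simps)
            also have "\<dots> \<le> real n * (exp (- t) - exp (- r))"
              using that d by (intro mult_right_mono) auto
            finally show ?thesis by (simp add: \<phi>_def)
          qed
          then show ?thesis using True
            by (intro tendsto_eventually) (auto simp: eventually_sequentially)
        next
          case False
          then have "real n * (exp (- t) - exp (- r)) \<le> 0" for n
            by (intro mult_nonneg_nonpos) auto
          then have "\<phi> n (exp (- t)) = 0" for n by (simp add: \<phi>_def)
          then show ?thesis using False by simp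
        qed
        then show "(\<lambda>n. \<phi> n (exp (- t)) * w t) \<longlonglongrightarrow> indicator {..<r} t *\<^sub>R w t"
          by (simp add: tendsto_mult_right)
      qed
      show "AE t in lborel. norm (\<phi> n (exp (- t)) * w t) \<le> \<bar>w t\<bar>" for n
        by (rule AE_I2) (auto simp: \<phi>_def abs_mult intro!: mult_left_le_one_le)
      show "(\<lambda>t. \<phi> n (exp (- t)) * w t) \<in> borel_measurable lborel" for n
        unfolding \<phi>_def by measurable
    qed (use w in auto)
    moreover have "(LINT t|lborel. \<phi> n (exp (- t)) * w t) = 0" for n
      unfolding \<phi>_def by (intro cont continuous_intros)
    ultimately have "(LINT t|lborel. indicator {..<r} t *\<^sub>R w t) = 0"
      by (simp add: LIMSEQ_const_iff)
    then show "(LINT t:{..<r}|lborel. w t) = 0" by (simp add: set_lebesgue_integral_def)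
  qed
qed

text \<open>Componentwise, the difference of the two responses is damped by
  \<open>exp (- (\<sigma> * t))\<close>. It becomes integrable, and its transform vanishes at all
  natural numbers, because both original transforms equal \<open>G\<close> at
  \<open>\<sigma> + n\<close>.\<close>

lemma impulse_response_AE_unique:
  assumes "impulse_response G g" "impulse_response G h"
  shows "AE t in lborel. t \<ge> 0 \<longrightarrow> g t = h t"
proof -
  obtain \<sigma>1 where g: "\<And>s i. Re s > \<sigma>1 \<Longrightarrow> set_integrable lborel {0..} (\<lambda>t. exp (- of_real t * s) * of_real (g t $ i))"
    "\<And>s i. Re s > \<sigma>1 \<Longrightarrow> (LINT t:{0..}|lborel. exp (- of_real t * s) * of_real (g t $ i)) = G s $ i"
    using assms(1) unfolding impulse_response_def by blast
  obtain \<sigma>2 where h: "\<And>s i. Re s > \<sigma>2 \<Longrightarrow> set_integrable lborel {0..} (\<lambda>t. exp (- of_real t * s) * of_real (h t $ i))"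
    "\<And>s i. Re s > \<sigma>2 \<Longrightarrow> (LINT t:{0..}|lborel. exp (- of_real t * s) * of_real (h t $ i)) = G s $ i"
    using assms(2) unfolding impulse_response_def by blast
  \<comment> \<open>Adding 1 places \<open>\<sigma>\<close> strictly inside both half-planes of
    convergence.\<close>
  define \<sigma> where "\<sigma> = max \<sigma>1 \<sigma>2 + 1"
  have "AE t in lborel. t \<ge> 0 \<longrightarrow> g t $ i = h t $ i" for i
  proof -
    define w where "w t = indicator {0..} t * (exp (- (\<sigma> * t)) * (g t $ i - h t $ i))" for t
    have W: "integrable lborel (\<lambda>t. complex_of_real (exp (- (real n * t)) * w t))"
      "(LINT t|lborel. complex_of_real (exp (- (real n * t)) * w t)) = 0" for n
    proof -
      let ?s = "complex_of_real (\<sigma> + real n)"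
      let ?d = "\<lambda>t. exp (- of_real t * ?s) * of_real (g t $ i) - exp (- of_real t * ?s) * of_real (h t $ i)"
      have s: "Re ?s > \<sigma>1" "Re ?s > \<sigma>2" by (auto simp: \<sigma>_def)
      have eq: "complex_of_real (exp (- (real n * t)) * w t) = indicator {0..} t *\<^sub>R ?d t" for t
      proof -
        have "exp (- of_real t * ?s) = complex_of_real (exp (- (\<sigma> * t)) * exp (- (real n * t)))"
        proof -
          have "- of_real t * ?s = of_real (- (\<sigma> * t) + - (real n * t))"
            by (simp add: algebra_simps)
          then show ?thesis by (simp only: exp_of_real exp_add)
        qed
        then show ?thesis by (simp add: w_def scaleR_conv_of_real algebra_simps)
      qed
      show "integrable lborel (\<lambda>t. complex_of_real (exp (- (real n * t)) * w t))"
        unfolding eq using set_integral_diff(1)[OF g(1)[OF s(1)] h(1)[OF s(2)]] by (simp add: set_integrable_def)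
      show "(LINT t|lborel. complex_of_real (exp (- (real n * t)) * w t)) = 0"
        unfolding eq using set_integral_diff(2)[OF g(1)[OF s(1)] h(1)[OF s(2)], of i i] g(2)[OF s(1), of i] h(2)[OF s(2), of i]
        by (simp add: set_lebesgue_integral_def)
    qed
    have "AE t in lborel. w t = 0"
    proof (rule AE_zero_if_laplace_zero_at_nat)
      show "integrable lborel w" using W(1)[of 0] by (simp add: complex_of_real_integrable_eq)
      show "(LINT t|lborel. exp (- (real n * t)) * w t) = 0" for n
        using W(2)[of n] unfolding integral_complex_of_real by simp
    qed (simp add: w_def)
    then show ?thesis by eventually_elim (auto simp: w_def)
  qed
  then have "AE t in lborel. \<forall>i\<in>UNIV. t \<ge> 0 \<longrightarrow> g t $ i = h t $ i"
    by (intro AE_finite_allI) simp_all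
  then show ?thesis by eventually_elim (simp add: vec_eq_iff)
qed

text \<open>Makes the \<open>SOME\<close> in \<open>L1_norm\<close> harmless: the norm may be
  computed from any response at hand.\<close>

lemma L1_norm_eq:
  assumes "impulse_response G g"
  shows "L1_norm G = (\<integral>\<^sup>+t\<in>{0..}. ennreal (norm (g t)) \<partial>lborel)"
proof -
  have "impulse_response G (SOME g. impulse_response G g)"
    by (rule someI[of "impulse_response G", OF assms])
  from impulse_response_AE_unique[OF this assms]
  have "(\<integral>\<^sup>+t\<in>{0..}. ennreal (norm ((SOME g. impulse_response G g) t)) \<partial>lborel) =
      (\<integral>\<^sup>+t\<in>{0..}. ennreal (norm (g t)) \<partial>lborel)"
    by (intro nn_integral_cong_AE) (auto elim!: eventually_mono simp: indicator_def)
  then show ?thesis unfolding L1_norm_def using assms by auto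
qed

section \<open>Exponential stability and norm estimate\<close>

text \<open>Mean value inequality in the delay \<open>x\<close>: the derivative
  \<open>- s * exp (- x s)\<close> is at most \<open>norm s * exp (\<alpha> * T)\<close> in modulus
  on \<open>{0..T}\<close>, even when \<open>Re s\<close> is slightly negative.\<close>

lemma norm_delay_difference_le:
  assumes "0 \<le> \<tau>" "0 \<le> \<tau>'" "\<tau> \<le> T" "\<tau>' \<le> T" "Re s \<ge> - \<alpha>" "0 \<le> \<alpha>"
  shows "norm (exp (- of_real \<tau> * s) - exp (- of_real \<tau>' * s)) \<le> \<bar>\<tau> - \<tau>'\<bar> * norm s * exp (\<alpha> * T)"
proof -
  have *: "norm (exp (- of_real x * s)) \<le> exp (\<alpha> * T)" if "0 \<le> x" "x \<le> T" for x
  proof -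
    have "- (x * Re s) \<le> x * \<alpha>" using assms(5) that mult_left_mono[of "- Re s" \<alpha> x] by simp
    also have "\<dots> \<le> T * \<alpha>" using that assms(6) by (intro mult_right_mono)
    finally show ?thesis by (simp add: mult.commute)
  qed
  have "norm (exp (- of_real \<tau> * s) - exp (- of_real \<tau>' * s)) \<le> (norm s * exp (\<alpha> * T)) * norm (\<tau> - \<tau>')"
  proof (rule differentiable_bound[of "{0..T}" "\<lambda>x. exp (- of_real x * s)" "\<lambda>x h. h *\<^sub>R (- s * exp (- of_real x * s))"])
    fix x assume x: "x \<in> {0..T}"
    show "((\<lambda>x. exp (- of_real x * s)) has_derivative (\<lambda>h. h *\<^sub>R (- s * exp (- of_real x * s)))) (at x within {0..T})"
      unfolding has_vector_derivative_def[symmetric]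
      by (auto intro!: derivative_eq_intros has_vector_derivative_real_field)
    show "onorm (\<lambda>h. h *\<^sub>R (- s * exp (- of_real x * s))) \<le> norm s * exp (\<alpha> * T)"
      using *[of x] x by (intro onorm_bound) (auto simp: norm_mult mult_left_mono mult.commute)
  qed (use assms in auto)
  then show ?thesis by (simp add: mult_ac)
qed

text \<open>\<open>L1_tf\<close> only sees \<open>Re s \<ge> 0\<close>, so the strip to its left is
  treated directly. A root with \<open>Re s > - (k / 2)\<close> has
  \<open>u = norm (s + k) > k / 2\<close>, while the equation bounds \<open>u\<close> by
  \<open>6 * u * (k * \<bar>\<tau> - \<tau>'\<bar>)\<close>, which is smaller than
  \<open>u\<close>.\<close>

lemma F_exp_stable_if_small_mismatch:
  assumes k: "k > 0" and \<tau>: "0 \<le> \<tau>" "0 \<le> \<tau>'" "k * \<tau> \<le> 1" "k * \<tau>' \<le> 1" and mismatch: "k * \<bar>\<tau> - \<tau>'\<bar> < 1 / 6"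
  shows "F_exp_stable k \<tau> \<tau>'"
  unfolding F_exp_stable_def
proof (intro exI[of _ "k / 2"] conjI allI impI)
  fix s assume root: "F_denom k \<tau> \<tau>' s = 0"
  show "Re s \<le> - (k / 2)"
  proof (rule ccontr)
    assume "\<not> Re s \<le> - (k / 2)"
    then have s: "Re s > - (k / 2)" by simp
    define u where "u = norm (s + of_real k)"
    have "k / 2 < Re (s + of_real k)" using s by simp
    also have "\<dots> \<le> u" unfolding u_def by (rule complex_Re_le_cmod)
    finally have u: "k < 2 * u" by simp
    have "norm s \<le> u + k"
      using norm_triangle_ineq4[of "s + of_real k" "of_real k"] k by (simp add: u_def)
    then have ns: "norm s \<le> 3 * u" using u by simp
    \<comment> \<open>With \<open>\<alpha> = k / 2\<close> and \<open>T = 1 / k\<close> the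
      exponential factor is \<open>exp (1 / 2)\<close>. The bound 2 for it and
      \<open>norm s \<le> 3 * u\<close> make up the constant 6.\<close>
    have e2: "exp (k / 2 * (1 / k)) \<le> 2"
      using exp_bound_half[of "1/2 :: real"] k by simp
    have "s + of_real k = - of_real k * (exp (- of_real \<tau> * s) - exp (- of_real \<tau>' * s))"
      using root by (simp add: F_denom_def algebra_simps)
    then have "u = k * norm (exp (- of_real \<tau> * s) - exp (- of_real \<tau>' * s))"
      using k by (simp add: u_def norm_mult)
    also have "\<dots> \<le> k * (\<bar>\<tau> - \<tau>'\<bar> * norm s * exp (k / 2 * (1 / k)))"
      using k \<tau> s by (intro mult_left_mono norm_delay_difference_le) (auto simp: field_simps)
    also have "\<dots> \<le> k * (\<bar>\<tau> - \<tau>'\<bar> * (3 * u) * 2)"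
      using k ns e2 u by (intro mult_left_mono mult_mono) auto
    also have "\<dots> = (6 * u) * (k * \<bar>\<tau> - \<tau>'\<bar>)" by simp
    also have "\<dots> < (6 * u) * (1 / 6)"
      using mismatch u k by (intro mult_strict_left_mono) auto
    finally show False by simp
  qed
qed (use k in simp)

text \<open>The real parts of the complex responses form a real response: their transform is the
  average of \<open>G s\<close> and \<open>cnj (G (cnj s))\<close>, which agree by
  \<open>sym\<close>. The Euclidean norm is at most the sum of the moduli of the components.\<close>

lemma L1_norm_le_sum:
  fixes G :: "complex \<Rightarrow> complex^'n"
  assumes G: "\<And>i. L1_tf (\<lambda>s. G s $ i) (c i)"
    and sym: "\<And>s i. Re s \<ge> 0 \<Longrightarrow> cnj (G (cnj s) $ i) = G s $ i"
  shows "L1_norm G \<le> ennreal (\<Sum>i\<in>UNIV. c i)"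
proof -
  have "\<exists>\<gamma>. \<forall>i. integrable lborel (\<gamma> i) \<and> (\<forall>t<0. \<gamma> i t = 0) \<and> (LINT t|lborel. norm (\<gamma> i t)) \<le> c i \<and>
     (\<forall>s. Re s \<ge> 0 \<longrightarrow> (LINT t|lborel. exp (- of_real t * s) * \<gamma> i t) = G s $ i)"
    using G unfolding L1_tf_def by (intro choice) blast
  then obtain \<gamma> where \<gamma>: "\<And>i. integrable lborel (\<gamma> i)" "\<And>i. \<forall>t<0. \<gamma> i t = 0"
      "\<And>i. (LINT t|lborel. norm (\<gamma> i t)) \<le> c i"
      "\<And>i s. Re s \<ge> 0 \<Longrightarrow> (LINT t|lborel. exp (- of_real t * s) * \<gamma> i t) = G s $ i"
    by blast
  define g where "g t = (\<chi> i. Re (\<gamma> i t))" for t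
  have "impulse_response G g"
    unfolding impulse_response_def
  proof (intro exI[of _ 0] allI impI)
    fix s :: complex and i assume "Re s > 0"
    then have s: "Re s \<ge> 0" "Re (cnj s) \<ge> 0" by auto
    let ?e = "\<lambda>t s. exp (- of_real t * s) * \<gamma> i t"
    have eq: "indicator {0..} t *\<^sub>R (exp (- of_real t * s) * of_real (g t $ i)) = (?e t s + cnj (?e t (cnj s))) / 2" for t
    proof (cases "t < 0")
      case False
      then show ?thesis
        by (simp add: g_def exp_cnj distrib_left[symmetric] complex_add_cnj)
    qed (use \<gamma>(2) in simp)
    have int: "integrable lborel (\<lambda>t. ?e t s)" "integrable lborel (\<lambda>t. cnj (?e t (cnj s)))"
      using laplace_integrable[OF \<gamma>(1,2)] s by (auto simp del: complex_cnj_mult simp: integrable_cnj)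
    have "(LINT t|lborel. cnj (?e t (cnj s))) = G s $ i"
      unfolding Bochner_Integration.integral_cnj using \<gamma>(4)[OF s(2), of i] sym[OF s(1), of i] by simp
    then show "set_integrable lborel {0..} (\<lambda>t. exp (- of_real t * s) * of_real (g t $ i)) \<and>
        (LINT t:{0..}|lborel. exp (- of_real t * s) * of_real (g t $ i)) = G s $ i"
      unfolding set_integrable_def set_lebesgue_integral_def eq
      using int \<gamma>(4)[OF s(1), of i] by (simp del: complex_cnj_mult)
  qed
  then have "L1_norm G = (\<integral>\<^sup>+t\<in>{0..}. ennreal (norm (g t)) \<partial>lborel)" by (rule L1_norm_eq)
  also have "\<dots> \<le> (\<integral>\<^sup>+t. (\<Sum>i\<in>UNIV. ennreal (norm (\<gamma> i t))) \<partial>lborel)"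
  proof (rule nn_integral_mono)
    fix t
    have "norm (g t) \<le> (\<Sum>i\<in>UNIV. \<bar>g t $ i\<bar>)" by (rule norm_le_l1_cart)
    also have "\<dots> \<le> (\<Sum>i\<in>UNIV. norm (\<gamma> i t))"
      by (intro sum_mono) (simp add: g_def abs_Re_le_cmod)
    finally have "ennreal (norm (g t)) \<le> (\<Sum>i\<in>UNIV. ennreal (norm (\<gamma> i t)))"
      by (simp add: sum_ennreal ennreal_leI)
    then show "ennreal (norm (g t)) * indicator {0..} t \<le> (\<Sum>i\<in>UNIV. ennreal (norm (\<gamma> i t)))"
      by (simp add: indicator_def)
  qed
  also have "\<dots> = (\<Sum>i\<in>UNIV. \<integral>\<^sup>+t. ennreal (norm (\<gamma> i t)) \<partial>lborel)"
    using \<gamma>(1)[THEN borel_measurable_integrable] by (intro nn_integral_sum) auto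
  also have "\<dots> = (\<Sum>i\<in>UNIV. ennreal (LINT t|lborel. norm (\<gamma> i t)))"
    using \<gamma>(1) by (intro sum.cong refl nn_integral_eq_integral) auto
  also have "\<dots> \<le> (\<Sum>i\<in>UNIV. ennreal (c i))"
    using \<gamma>(3) by (intro sum_mono ennreal_leI)
  also have "\<dots> = ennreal (\<Sum>i\<in>UNIV. c i)"
    using L1_tf_nonneg[OF G] by (intro sum_ennreal)
  finally show ?thesis .
qed

section \<open>Resolvent identity and conjugation symmetry for \<open>H\<close> and
  \<open>\<Phi>\<close>, and the norm estimate\<close>

lemma hurwitz_stable:
  assumes "hurwitz A" "v \<noteq> 0" "map_matrix complex_of_real A *v v = s *s v"
  shows "Re s < 0"
  using assms unfolding hurwitz_def by blast

lemma H_tf_resolvent: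
  "H_tf A b s = resolvent (map_matrix complex_of_real A) s (\<chi> i. of_real (b $ i))"
  by (simp add: H_tf_def resolvent_def)

text \<open>The identity \<open>s H = A H + b\<close> trades the unbounded factor \<open>s\<close>
  for constant coefficients; the gain \<open>1 / k\<close> of the term \<open>(1 - K) H\<close>
  rests on it.\<close>

lemma H_tf_component:
  assumes "hurwitz A" "Re s \<ge> 0"
  shows "s * H_tf A b s $ i = (\<Sum>j\<in>UNIV. of_real (A $ i $ j) * H_tf A b s $ j) + of_real (b $ i)"
proof -
  have "s *s H_tf A b s - map_matrix complex_of_real A *v H_tf A b s = (\<chi> i. of_real (b $ i))"
    unfolding H_tf_resolvent
    by (rule resolvent_inverse(1)) (use hurwitz_stable[OF assms(1)] assms(2) in auto)
  from arg_cong[OF this, of "\<lambda>v. v $ i"] show ?thesis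
    by (simp add: matrix_vector_mult_def map_matrix_def algebra_simps)
qed

text \<open>As \<open>A\<close> and \<open>b\<close> are real, conjugating the resolvent equation at
  \<open>cnj s\<close> gives the one at \<open>s\<close>, whose solution is unique.\<close>

lemma H_tf_cnj:
  assumes "hurwitz A" "Re s \<ge> 0"
  shows "cnj (H_tf A b (cnj s) $ i) = H_tf A b s $ i"
proof -
  have "H_tf A b s = (\<chi> i. cnj (H_tf A b (cnj s) $ i))"
    unfolding H_tf_resolvent[of A b s]
  proof (rule resolvent_eqI)
    show "s *s (\<chi> i. cnj (H_tf A b (cnj s) $ i)) -
        map_matrix complex_of_real A *v (\<chi> i. cnj (H_tf A b (cnj s) $ i)) = (\<chi> i. of_real (b $ i))"
    proof (subst vec_eq_iff, rule allI)
      fix i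
      have "cnj (cnj s * H_tf A b (cnj s) $ i) =
          cnj ((\<Sum>j\<in>UNIV. of_real (A $ i $ j) * H_tf A b (cnj s) $ j) + of_real (b $ i))"
        using H_tf_component[OF assms(1), of "cnj s" b i] assms(2) by simp
      then show "(s *s (\<chi> i. cnj (H_tf A b (cnj s) $ i)) -
        map_matrix complex_of_real A *v (\<chi> i. cnj (H_tf A b (cnj s) $ i))) $ i = (\<chi> i. complex_of_real (b $ i)) $ i"
        by (simp add: matrix_vector_mult_def map_matrix_def)
    qed
  qed (use hurwitz_stable[OF assms(1)] assms(2) in auto)
  then show ?thesis by simp
qed

lemma Phi_tf_cnj:
  assumes "hurwitz A" "Re s \<ge> 0"
  shows "cnj (Phi_tf k A b \<tau> \<tau>' (cnj s) $ i) = Phi_tf k A b \<tau> \<tau>' s $ i"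
  using H_tf_cnj[OF assms] by (simp add: Phi_tf_def F_tf_def F_denom_def exp_cnj)

lemma L1_tf_Phi:
  fixes A :: "real^'n^'n"
  assumes A: "hurwitz A" and k: "k > 0" and \<tau>: "\<tau> \<ge> 0" "\<tau>' \<ge> 0" and mismatch: "4 * k * \<bar>\<tau> - \<tau>'\<bar> \<le> 1"
    and H: "\<And>j. L1_tf (\<lambda>s. H_tf A b s $ j) (c j)"
  shows "L1_tf (\<lambda>s. Phi_tf k A b \<tau> \<tau>' s $ i)
    (((\<Sum>j\<in>UNIV. \<bar>A $ i $ j\<bar> * c j) + \<bar>b $ i\<bar>) / k + (2 * k * \<tau> + 4 * k * \<bar>\<tau> - \<tau>'\<bar>) * c i)"
proof -
  let ?H = "\<lambda>j s. H_tf A b s $ j"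
  define D where "D s = lag k s * (exp (- of_real \<tau> * s) - exp (- of_real \<tau>' * s))" for s
  define d where "d = 2 * k * \<bar>\<tau> - \<tau>'\<bar>"
  have d: "0 \<le> d" "d \<le> 1 / 2" using k mismatch by (simp_all add: d_def)
  have D: "L1_tf D d"
    unfolding D_def[abs_def] d_def by (rule L1_tf_delay_difference[OF k \<tau>])
  have K: "L1_tf (lag k) 1" by (rule L1_tf_lag[OF k])
  have AH: "L1_tf (\<lambda>s. \<Sum>j\<in>UNIV. of_real (A $ i $ j) * ?H j s) (\<Sum>j\<in>UNIV. \<bar>A $ i $ j\<bar> * c j)"
    using L1_tf_cmult[OF H, of "of_real (A $ i $ j)" for j] by (intro L1_tf_sum) simp
  \<comment> \<open>This is \<open>(1 - K) H\<close>, rewritten by \<open>1 - K = K s / k\<close>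
    and \<open>s H = A H + b\<close>.\<close>
  have lowpass: "L1_tf (\<lambda>s. of_real (1 / k) * (lag k s * (\<Sum>j\<in>UNIV. of_real (A $ i $ j) * ?H j s))
      + of_real (b $ i / k) * lag k s) ((1 / k) * (1 * (\<Sum>j\<in>UNIV. \<bar>A $ i $ j\<bar> * c j)) + \<bar>b $ i\<bar> / k * 1)"
    using L1_tf_add[OF L1_tf_cmult[OF L1_tf_mult[OF K AH], of "of_real (1 / k)"] L1_tf_cmult[OF K, of "of_real (b $ i / k)"]] k
    by (simp add: norm_divide)
  have delay: "L1_tf (\<lambda>s. (lag k s * (1 - exp (- of_real \<tau> * s))) * ?H i s) (2 * k * \<tau> * c i)"
    by (rule L1_tf_mult[OF L1_tf_lag_difference[OF k \<tau>(1)] H])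
  have feedback: "L1_tf (\<lambda>s. exp (- of_real \<tau> * s) * (D s / (1 + D s) * (lag k s * ?H i s))) (d / (1 - d) * (1 * c i))"
    using d by (intro L1_tf_delay L1_tf_mult L1_tf_neumann D K H \<tau>) simp
  show ?thesis
  proof (rule L1_tf_weaken[OF L1_tf_add[OF lowpass L1_tf_add[OF delay feedback]]])
    \<comment> \<open>Here \<open>d \<le> 1 / 2\<close> is used; it turns the Neumann bound into a
      linear one and explains the factor 4 before the mismatch.\<close>
    have "d / (1 - d) \<le> 2 * d" using d mult_left_mono[of d "1 / 2" d] by (simp add: field_simps)
    then have "d / (1 - d) * c i \<le> 2 * d * c i"
      using L1_tf_nonneg[OF H] by (intro mult_right_mono)
    then show "1 / k * (1 * (\<Sum>j\<in>UNIV. \<bar>A $ i $ j\<bar> * c j)) + \<bar>b $ i\<bar> / k * 1 +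
       (2 * k * \<tau> * c i + d / (1 - d) * (1 * c i))
      \<le> ((\<Sum>j\<in>UNIV. \<bar>A $ i $ j\<bar> * c j) + \<bar>b $ i\<bar>) / k + (2 * k * \<tau> + 4 * k * \<bar>\<tau> - \<tau>'\<bar>) * c i"
      by (simp add: d_def add_divide_distrib distrib_right)
    fix s :: complex assume s: "Re s \<ge> 0"
    define e where "e = exp (- of_real \<tau> * s)"
    have sk: "s + of_real k \<noteq> 0" by (rule lag_denominator_nonzero[OF k s])
    have D1: "1 + D s \<noteq> 0"
    proof
      assume "1 + D s = 0"
      then have "norm (D s) = 1" by (metis add.commute add_eq_0_iff norm_minus_cancel norm_one)
      then show False using L1_tf_norm_le[OF D s] d by simp
    qed
    have "F_denom k \<tau> \<tau>' s = (s + of_real k) * (1 + D s)"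
      using sk by (simp add: F_denom_def D_def lag_def distrib_left) (simp add: algebra_simps)
    then have "F_tf k \<tau> \<tau>' s = - (lag k s * (1 / (1 + D s)))"
      by (simp add: F_tf_def lag_def divide_inverse)
    moreover define q where "q = D s / (1 + D s)"
    moreover have "1 / (1 + D s) = 1 - D s / (1 + D s)"
      using D1 by (simp add: field_simps)
    ultimately have F: "F_tf k \<tau> \<tau>' s = - (lag k s * (1 - q))"
      by (simp only:)
    have lag1: "1 - lag k s = of_real (1 / k) * lag k s * s"
      using sk k by (simp add: lag_def field_simps)
    have "of_real (1 / k) * (lag k s * (\<Sum>j\<in>UNIV. of_real (A $ i $ j) * ?H j s)) + of_real (b $ i / k) * lag k s
        = of_real (1 / k) * lag k s * ((\<Sum>j\<in>UNIV. of_real (A $ i $ j) * ?H j s) + of_real (b $ i))"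
      by (simp add: algebra_simps)
    also have "\<dots> = (1 - lag k s) * ?H i s"
      unfolding lag1 H_tf_component[OF A s, symmetric] by simp
    finally have "of_real (1 / k) * (lag k s * (\<Sum>j\<in>UNIV. of_real (A $ i $ j) * ?H j s)) + of_real (b $ i / k) * lag k s +
        (lag k s * (1 - e) * ?H i s + e * (q * (lag k s * ?H i s)))
        = (1 - lag k s + lag k s * (1 - e) + e * lag k s * q) * ?H i s"
      by (simp add: algebra_simps)
    also have "\<dots> = Phi_tf k A b \<tau> \<tau>' s $ i"
      unfolding Phi_tf_def F e_def[symmetric] by (simp add: algebra_simps)
    finally show "of_real (1 / k) * (lag k s * (\<Sum>j\<in>UNIV. of_real (A $ i $ j) * ?H j s)) + of_real (b $ i / k) * lag k s +
        (lag k s * (1 - exp (- of_real \<tau> * s)) * ?H i s + exp (- of_real \<tau> * s) * (D s / (1 + D s) * (lag k s * ?H i s)))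
        = Phi_tf k A b \<tau> \<tau>' s $ i"
      unfolding e_def q_def .
  qed
qed

theorem lemma1:
  fixes A :: "real^'n^'n" and b :: "real^'n" and \<theta>\<^sub>b :: real
  assumes "hurwitz A" and "\<theta>\<^sub>b > 0"
  shows "\<exists>k \<tau>\<^sub>s \<delta>lo \<delta>hi. k > 0 \<and> \<tau>\<^sub>s > 0 \<and> \<delta>lo > 0 \<and> \<delta>hi > 0 \<and>
           (\<forall>\<tau>\<in>{0..\<tau>\<^sub>s}. \<forall>\<tau>'. \<tau>' \<ge> 0 \<and> \<tau>' \<in> {\<tau> - \<delta>lo..\<tau> + \<delta>hi} \<longrightarrow>
              F_exp_stable k \<tau> \<tau>' \<and> f_norm k A b \<tau> \<tau>' * ennreal \<theta>\<^sub>b < 1)"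
proof -
  have "\<exists>c. L1_tf (\<lambda>s. H_tf A b s $ j) c" for j
    unfolding H_tf_resolvent by (rule L1_tf_resolvent) (use hurwitz_stable[OF assms(1)] in auto)
  then obtain c where H: "\<And>j. L1_tf (\<lambda>s. H_tf A b s $ j) (c j)" by metis
  have c: "0 \<le> c j" for j using L1_tf_nonneg[OF H] .
  define C where "C = (\<Sum>i\<in>UNIV. (\<Sum>j\<in>UNIV. \<bar>A $ i $ j\<bar> * c j) + \<bar>b $ i\<bar>)"
  define c0 where "c0 = (\<Sum>i\<in>UNIV. c i)"
  have C: "0 \<le> C" and c0: "0 \<le> c0"
    using c by (auto simp: C_def c0_def intro!: sum_nonneg add_nonneg_nonneg)
  \<comment> \<open>Makes \<open>C / k * \<theta>\<^sub>b < 1 / 2\<close>, with \<open>k\<close>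
    positive even if \<open>C = 0\<close>.\<close>
  define k where "k = 2 * \<theta>\<^sub>b * C + 1"
  \<comment> \<open>Bounds both \<open>k * \<tau>\<close> and
    \<open>k * \<bar>\<tau> - \<tau>'\<bar>\<close>. The delay terms then total at most
    \<open>6 * \<eta> * c0 * \<theta>\<^sub>b < 1 / 2\<close>, where 6 is 2 + 4, and
    \<open>\<eta> \<le> 1 / 12\<close> meets the smallness conditions for stability and for the
    Neumann series.\<close>
  define \<eta> where "\<eta> = 1 / (12 * \<theta>\<^sub>b * c0 + 12)"
  have k: "k > 0" using C assms(2) by (simp add: k_def add_nonneg_pos)
  have den: "12 * \<theta>\<^sub>b * c0 + 12 \<ge> 12" using c0 assms(2) by simp
  have \<eta>: "\<eta> > 0" "\<eta> \<le> 1 / 12" and \<eta>c: "12 * \<theta>\<^sub>b * c0 * \<eta> < 1"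
    using den by (auto simp: \<eta>_def field_simps)
  have goal: "F_exp_stable k \<tau> \<tau>' \<and> f_norm k A b \<tau> \<tau>' * ennreal \<theta>\<^sub>b < 1"
    if \<tau>: "0 \<le> \<tau>" "\<tau> \<le> \<eta> / k" "0 \<le> \<tau>'" "\<tau> - \<eta> / k \<le> \<tau>'" "\<tau>' \<le> \<tau> + \<eta> / k" for \<tau> \<tau>'
  proof
    have k\<tau>: "k * \<tau> \<le> \<eta>" using \<tau>(2) k by (simp add: field_simps)
    have mismatch: "k * \<bar>\<tau> - \<tau>'\<bar> \<le> \<eta>"
    proof -
      have "\<bar>\<tau> - \<tau>'\<bar> \<le> \<eta> / k" using \<tau>(4,5) by linarith
      then show ?thesis using k by (simp add: field_simps)
    qed
    have k\<tau>': "k * \<tau>' \<le> 2 * \<eta>"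
    proof -
      have "\<tau>' \<le> \<eta> / k + \<eta> / k" using \<tau>(2,5) by linarith
      then show ?thesis using k by (simp add: field_simps)
    qed
    show "F_exp_stable k \<tau> \<tau>'"
      using k \<tau> k\<tau> k\<tau>' mismatch \<eta> by (intro F_exp_stable_if_small_mismatch) auto
    let ?r = "\<lambda>i. ((\<Sum>j\<in>UNIV. \<bar>A $ i $ j\<bar> * c j) + \<bar>b $ i\<bar>) / k + (2 * k * \<tau> + 4 * k * \<bar>\<tau> - \<tau>'\<bar>) * c i"
    have "f_norm k A b \<tau> \<tau>' \<le> ennreal (\<Sum>i\<in>UNIV. ?r i)"
      unfolding f_norm_def
      using L1_tf_Phi[OF assms(1) k \<tau>(1,3) _ H] mismatch \<eta> Phi_tf_cnj[OF assms(1)]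
      by (intro L1_norm_le_sum) auto
    also have "(\<Sum>i\<in>UNIV. ?r i) = C / k + (2 * k * \<tau> + 4 * k * \<bar>\<tau> - \<tau>'\<bar>) * c0"
      unfolding C_def c0_def by (subst sum.distrib) (simp only: sum_divide_distrib sum_distrib_left)
    finally have "f_norm k A b \<tau> \<tau>' * ennreal \<theta>\<^sub>b \<le> ennreal (C / k + (2 * k * \<tau> + 4 * k * \<bar>\<tau> - \<tau>'\<bar>) * c0) * ennreal \<theta>\<^sub>b"
      by (rule mult_right_mono) simp
    also have "\<dots> = ennreal ((C / k + (2 * k * \<tau> + 4 * k * \<bar>\<tau> - \<tau>'\<bar>) * c0) * \<theta>\<^sub>b)"
      using C c0 k \<tau> assms(2) by (intro ennreal_mult[symmetric]) auto
    also have "\<dots> < ennreal 1"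
    proof (rule ennreal_lessI)
      have "(2 * k * \<tau> + 4 * k * \<bar>\<tau> - \<tau>'\<bar>) * c0 * \<theta>\<^sub>b \<le> (6 * \<eta>) * c0 * \<theta>\<^sub>b"
        using k\<tau> mismatch c0 assms(2) by (intro mult_right_mono) linarith+
      moreover have "12 * \<theta>\<^sub>b * c0 * \<eta> = 2 * ((6 * \<eta>) * c0 * \<theta>\<^sub>b)"
        by simp
      moreover have "C / k * \<theta>\<^sub>b < 1 / 2"
        using k by (simp add: field_simps) (simp add: k_def)
      ultimately show "(C / k + (2 * k * \<tau> + 4 * k * \<bar>\<tau> - \<tau>'\<bar>) * c0) * \<theta>\<^sub>b < 1"
        unfolding distrib_right[of "C / k"] using \<eta>c by linarith
    qed simp
    finally show "f_norm k A b \<tau> \<tau>' * ennreal \<theta>\<^sub>b < 1" by simp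
  qed
  \<comment> \<open>The single value \<open>\<eta> / k\<close> serves as delay bound and as both
    mismatch margins.\<close>
  show ?thesis
    using goal k \<eta>(1) by (intro exI[of _ k] exI[of _ "\<eta> / k"]) auto
qed

end
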